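(* Let $n\ge1$, let $D$ be an $n\times n$ matrix with nonnegative real entries, let $q>n$ be a prime power, $r=\lfloor(q-1)/2\rfloor$, and $\gamma=\frac{q}{3r}\left(\frac12-\frac rq\right)^2$. For any $\delta>0$, the PERM-WISH algorithm run on $D$ with parameters $q,r,\delta$ makes $\Theta(n\log\frac n\delta)$ calls to the MAX-oracle and, with probability at least $1-\delta$, outputs $\hat Z$ that is a $(q/r)^2=(4+O(1/n))$-approximation of $\mathrm{Perm}(D)$, i.e. $\mathrm{Perm}(D)/(q/r)^2\le\hat Z\le (q/r)^2\,\mathrm{Perm}(D)$.
   Context: $\mathrm{Perm}(D)=\sum_{\sigma\in S_n}\prod_{i=1}^nD_{i,\sigma(i)}$, where $S_n$ is the symmetric group; write $w(\sigma)=\prod_{i=1}^n D_{i,\sigma(i)}$. Fix an enumeration $\mathbb{F}_q=\{\alpha_0,\dots,\alpha_{q-1}\}$ with $\alpha_a<\alpha_b$ iff $a<b$ (an ordering only); for vectors, $u<v$ means coordinatewise $<$; $\mathbf 1$ is the all-ones vector. Identify each $\sigma\in S_n$ with the vector $(\alpha_{\sigma(1)-1},\dots,\alpha_{\sigma(n)-1})\in\mathbb{F}_q^n$. The MAX-oracle, given $A\in\mathbb{F}_q^{m\times n}$, $b\in\mathbb{F}_q^m$, returns exactly $\max\{w(\sigma):\sigma\in S_n,\ A\sigma+b<\alpha_r\cdot\mathbf 1\}$ (arithmetic in $\mathbb{F}_q$; max over the empty set is $0$). PERM-WISH: set $\ell=\lceil\frac1\gamma\ln\frac{2n}\delta\rceil$,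 $n'=\lceil n\log_{q/r}q\rceil$, $M_0=\max_{\sigma\in S_n}w(\sigma)$. For $i=1,\dots,n'$ and $k=1,\dots,\ell$, independently sample $A^i\in\mathbb{F}_q^{i\times n}$, $b^i\in\mathbb{F}_q^i$ with independent uniform entries and let $w_i^{(k)}$ be the oracle value for $(A^i,b^i)$; let $M_i$ be the median of $w_i^{(1)},\dots,w_i^{(\ell)}$. Output $\hat Z=M_0+\left(\frac qr-1\right)\sum_{i=0}^{n'-1}M_{i+1}\left(\frac qr\right)^i$.
   Formalization: The call count is not Θ(n log(n/δ)) uniformly in q (1/γ is of order q²): it is proved with constants depending on q, and uniformly with the extra factor log_{q/r}(q)/γ, both for n/δ ≥ c with any fixed c > 1; q = 2 (where r = 0 and q/r is undefined) is excluded. *)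

theory Defs
  imports
    "HOL-Probability.Probability"
    "HOL-Library.Landau_Symbols"
    "HOL-Number_Theory.Prime_Powers"
    "Jordan_Normal_Form.Matrix"
begin

no_notation vec_nth (infixl \<open>$\<close> 90)

text \<open>Matrices, vectors and permutations are indexed from \<open>0\<close>, so that \<open>S\<^sub>n\<close> is the set of
  permutations of \<open>{0..<n}\<close>.\<close>

definition perm_weight :: "'a::comm_semiring_1 mat \<Rightarrow> (nat \<Rightarrow> nat) \<Rightarrow> 'a" where
  "perm_weight D \<sigma> = (\<Prod>i\<in>{0..<dim_row D}. D $$ (i, \<sigma> i))"

definition permanent :: "'a::comm_semiring_1 mat \<Rightarrow> 'a" where
  "permanent D = (\<Sum>\<sigma> | \<sigma> permutes {0..<dim_row D}. perm_weight D \<sigma>)"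

text \<open>Below, \<open>\<alpha>\<close> enumerates a finite field as \<open>\<alpha> 0, \<dots>, \<alpha> (q - 1)\<close>. The order it induces is
  unrelated to the field operations.\<close>

definition enum_less :: "(nat \<Rightarrow> 'f::finite) \<Rightarrow> 'f \<Rightarrow> 'f \<Rightarrow> bool" where
  "enum_less \<alpha> x y \<longleftrightarrow> (\<exists>a b. a < b \<and> b < CARD('f) \<and> x = \<alpha> a \<and> y = \<alpha> b)"

definition enum_vec_less :: "(nat \<Rightarrow> 'f::finite) \<Rightarrow> 'f Matrix.vec \<Rightarrow> 'f Matrix.vec \<Rightarrow> bool" where
  "enum_vec_less \<alpha> u v \<longleftrightarrow> dim_vec u = dim_vec v \<and> (\<forall>j<dim_vec u. enum_less \<alpha> (u $ j) (v $ j))"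

text \<open>With 0-based permutations the \<open>i\<close>-th coordinate is \<open>\<alpha> (\<sigma> i)\<close>, not \<open>\<alpha> (\<sigma> i - 1)\<close>.\<close>

definition perm_vec :: "(nat \<Rightarrow> 'f) \<Rightarrow> nat \<Rightarrow> (nat \<Rightarrow> nat) \<Rightarrow> 'f Matrix.vec" where
  "perm_vec \<alpha> n \<sigma> = Matrix.vec n (\<lambda>i. \<alpha> (\<sigma> i))"

definition max_oracle ::
  "(nat \<Rightarrow> 'f::{field,finite}) \<Rightarrow> nat \<Rightarrow> real mat \<Rightarrow> 'f mat \<Rightarrow> 'f Matrix.vec \<Rightarrow> real" where
  "max_oracle \<alpha> r D A b =
    (let n = dim_row D;
         W = {perm_weight D \<sigma> | \<sigma>. \<sigma> permutes {0..<n} \<and>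
               enum_vec_less \<alpha> (A *\<^sub>v perm_vec \<alpha> n \<sigma> + b)
                 (\<alpha> r \<cdot>\<^sub>v Matrix.vec (dim_row A) (\<lambda>_. 1))}
     in if W = {} then 0 else Max W)"

text \<open>For an even number of values, the mean of the two middle ones.\<close>

definition median :: "real list \<Rightarrow> real" where
  "median xs =
    (let s = sort xs; l = length xs
     in if odd l then s ! (l div 2) else (s ! (l div 2 - 1) + s ! (l div 2)) / 2)"

definition wish_r :: "nat \<Rightarrow> nat" where
  "wish_r q = (q - 1) div 2"

definition wish_gamma :: "nat \<Rightarrow> nat \<Rightarrow> real" where
  "wish_gamma q r = real q / (3 * real r) * (1 / 2 - real r / real q)\<^sup>2"

definition wish_reps :: "nat \<Rightarrow> nat \<Rightarrow> nat \<Rightarrow> real \<Rightarrow> nat" where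
  "wish_reps n q r \<delta> = nat \<lceil>1 / wish_gamma q r * ln (2 * real n / \<delta>)\<rceil>"

definition wish_levels :: "nat \<Rightarrow> nat \<Rightarrow> nat \<Rightarrow> nat" where
  "wish_levels n q r = nat \<lceil>real n * log (real q / real r) (real q)\<rceil>"

text \<open>The algorithm makes one oracle call for each pair \<open>(i, k)\<close> of a level and a repetition.\<close>

definition wish_queries :: "nat \<Rightarrow> nat \<Rightarrow> nat \<Rightarrow> real \<Rightarrow> (nat \<times> nat) set" where
  "wish_queries n q r \<delta> = {1..wish_levels n q r} \<times> {1..wish_reps n q r \<delta>}"

definition wish_calls :: "nat \<Rightarrow> nat \<Rightarrow> nat \<Rightarrow> real \<Rightarrow> nat" where
  "wish_calls n q r \<delta> = card (wish_queries n q r \<delta>)"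

definition uniform_mat :: "nat \<Rightarrow> nat \<Rightarrow> 'f::{field,finite} mat pmf" where
  "uniform_mat m n =
    map_pmf (Matrix.mat m n) (Pi_pmf ({0..<m} \<times> {0..<n}) 0 (\<lambda>_. pmf_of_set UNIV))"

definition uniform_vec :: "nat \<Rightarrow> 'f::{field,finite} Matrix.vec pmf" where
  "uniform_vec m = map_pmf (Matrix.vec m) (Pi_pmf {0..<m} 0 (\<lambda>_. pmf_of_set UNIV))"

definition wish_samples ::
  "nat \<Rightarrow> nat \<Rightarrow> nat \<Rightarrow> real \<Rightarrow> (nat \<times> nat \<Rightarrow> 'f::{field,finite} mat \<times> 'f Matrix.vec) pmf" where
  "wish_samples n q r \<delta> =
    Pi_pmf (wish_queries n q r \<delta>) undefined (\<lambda>(i, k). pair_pmf (uniform_mat i n) (uniform_vec i))"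

definition wish_median ::
  "(nat \<Rightarrow> 'f::{field,finite}) \<Rightarrow> real mat \<Rightarrow> nat \<Rightarrow> nat \<Rightarrow> real \<Rightarrow>
    (nat \<times> nat \<Rightarrow> 'f mat \<times> 'f Matrix.vec) \<Rightarrow> nat \<Rightarrow> real" where
  "wish_median \<alpha> D q r \<delta> S i =
    median (map (\<lambda>k. max_oracle \<alpha> r D (fst (S (i, k))) (snd (S (i, k))))
      [1..<Suc (wish_reps (dim_row D) q r \<delta>)])"

definition wish_estimate ::
  "(nat \<Rightarrow> 'f::{field,finite}) \<Rightarrow> real mat \<Rightarrow> nat \<Rightarrow> nat \<Rightarrow> real \<Rightarrow>
    (nat \<times> nat \<Rightarrow> 'f mat \<times> 'f Matrix.vec) \<Rightarrow> real" where
  "wish_estimate \<alpha> D q r \<delta> S =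
    Max (perm_weight D ` {\<sigma>. \<sigma> permutes {0..<dim_row D}}) +
    (real q / real r - 1) *
      (\<Sum>i<wish_levels (dim_row D) q r. wish_median \<alpha> D q r \<delta> S (i + 1) * (real q / real r) ^ i)"

definition perm_wish ::
  "(nat \<Rightarrow> 'f::{field,finite}) \<Rightarrow> real mat \<Rightarrow> nat \<Rightarrow> nat \<Rightarrow> real \<Rightarrow> real pmf" where
  "perm_wish \<alpha> D q r \<delta> =
    map_pmf (wish_estimate \<alpha> D q r \<delta>) (wish_samples (dim_row D) q r \<delta>)"

end

theory Submission
  imports Defs
begin

text \<open>
  Let \<open>Q = q / r\<close> and let \<open>s 0 \<ge> s 1 \<ge> \<dots>\<close> be the \<open>n!\<close> permutation weights in decreasing order,
  continued by \<open>0\<close>. The permanent is the integral of the step function \<open>x \<mapsto> s \<lfloor>x\<rfloor>\<close>, and the estimate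
  is a quadrature of it on a geometric grid of ratio \<open>Q\<close>: it is off by at most a factor \<open>Q\<^sup>2\<close> as
  soon as, for every \<open>i\<close>, the median \<open>M\<close> of level \<open>i + 1\<close> satisfies
  \<open>s \<lfloor>Q ^ (i + 2)\<rfloor> \<le> M \<le> s \<lfloor>Q ^ (i - 1)\<rfloor>\<close>.

  The events that a permutation survives \<open>i\<close> random constraints have probability \<open>Q ^ (-i)\<close> and are
  pairwise independent. A union bound shows that one oracle value violates the upper inequality with
  probability at most \<open>Q ^ (-2)\<close>, and the second moment method that it violates the lower one with
  probability at most \<open>1 / (1 + Q)\<close>. By Hoeffding's inequality the median then violates either one
  with probability at most \<open>(\<delta> / (2 n)) ^ (r + 1)\<close>. There are \<open>n log\<^sub>Q q\<close> rather than \<open>n\<close> levels, so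
  the exponent \<open>1\<close> would not be enough for the union bound over the levels, but \<open>r + 1\<close> is.
\<close>

section \<open>Order statistics\<close>

lemma nth_sorted_list_of_multiset_iff:
  assumes "mono P" and k: "k < size M"
  shows "P (sorted_list_of_multiset M ! k) \<longleftrightarrow> size {#x \<in># M. \<not> P x#} \<le> k"
proof -
  define xs where "xs = sorted_list_of_multiset M"
  have length_xs: "length xs = size M"
    by (metis xs_def mset_sorted_list_of_multiset size_mset)
  have "size {#x \<in># M. \<not> P x#} = length (filter (\<lambda>x. \<not> P x) xs)"
    by (metis xs_def mset_filter mset_sorted_list_of_multiset size_mset)
  then have size_eq_card: "size {#x \<in># M. \<not> P x#} = card {i. i < size M \<and> \<not> P (xs ! i)}"
    by (simp add: length_filter_conv_card length_xs)
  have P_mono: "P (xs ! j)" if "P (xs ! i)" "i \<le> j" "j < size M" for i j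
    using that \<open>mono P\<close> sorted_nth_mono[of xs i j] length_xs by (auto simp: xs_def mono_def)
  show ?thesis
  proof (cases "P (xs ! k)")
    case True
    have "{i. i < size M \<and> \<not> P (xs ! i)} \<subseteq> {..<k}"
    proof
      fix i assume "i \<in> {i. i < size M \<and> \<not> P (xs ! i)}"
      then show "i \<in> {..<k}"
        using P_mono[OF True, of i] by (cases "k \<le> i") auto
    qed
    from card_mono[OF _ this] True show ?thesis
      by (simp add: size_eq_card flip: xs_def)
  next
    case False
    have "{..k} \<subseteq> {i. i < size M \<and> \<not> P (xs ! i)}"
    proof
      fix i assume "i \<in> {..k}"
      then show "i \<in> {i. i < size M \<and> \<not> P (xs ! i)}"
        using P_mono[of i k] False k by auto
    qed
    from card_mono[OF _ this] False show ?thesis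
      by (simp add: size_eq_card flip: xs_def)
  qed
qed

lemma median_bounds:
  assumes "xs \<noteq> []"
  shows "sort xs ! ((length xs - 1) div 2) \<le> median xs" "median xs \<le> sort xs ! (length xs div 2)"
proof -
  have "sort xs ! ((length xs - 1) div 2) \<le> sort xs ! (length xs div 2)"
    using assms by (intro sorted_nth_mono) auto
  moreover have "(length xs - 1) div 2 =
      (if odd (length xs) then length xs div 2 else length xs div 2 - 1)"
    by presburger
  ultimately show "sort xs ! ((length xs - 1) div 2) \<le> median xs"
    "median xs \<le> sort xs ! (length xs div 2)"
    by (auto simp: median_def Let_def)
qed

lemma median_gt_imp_half:
  assumes "v < median xs"
  shows "length xs \<le> 2 * length (filter (\<lambda>x. v < x) xs)"
proof (cases "xs = []")
  case False
  then have "v < sort xs ! (length xs div 2)"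
    using assms median_bounds(2)[of xs] by linarith
  then have "length (filter (\<lambda>x. \<not> v < x) xs) \<le> length xs div 2"
    using nth_sorted_list_of_multiset_iff[of "\<lambda>x. v < x" "length xs div 2" "mset xs"] False
    by (auto simp: mono_def simp flip: mset_filter)
  then show ?thesis
    using sum_length_filter_compl[of "\<lambda>x. v < x" xs] by linarith
qed simp

lemma median_lt_imp_half:
  assumes "median xs < v"
  shows "length xs \<le> 2 * length (filter (\<lambda>x. x < v) xs)"
proof (cases "xs = []")
  case False
  then have "\<not> v \<le> sort xs ! ((length xs - 1) div 2)"
    using assms median_bounds(1)[of xs] by linarith
  moreover have "(length xs - 1) div 2 < length xs"
    using False by (cases xs) auto
  ultimately have "(length xs - 1) div 2 < length (filter (\<lambda>x. \<not> v \<le> x) xs)"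
    using nth_sorted_list_of_multiset_iff[of "\<lambda>x. v \<le> x" "(length xs - 1) div 2" "mset xs"]
    by (auto simp: mono_def simp flip: mset_filter)
  then show ?thesis
    by (simp add: not_le)
qed simp

definition decreasing_rearrangement ::
  "('a \<Rightarrow> 'b::{linorder,comm_monoid_add}) \<Rightarrow> 'a set \<Rightarrow> nat \<Rightarrow> 'b" where
  "decreasing_rearrangement w X k =
    (if k < card X then rev (sorted_list_of_multiset (image_mset w (mset_set X))) ! k else 0)"

lemma decreasing_rearrangement_zero: "card X \<le> k \<Longrightarrow> decreasing_rearrangement w X k = 0"
  by (simp add: decreasing_rearrangement_def)

lemma decreasing_rearrangement_iff:
  assumes "mono P" and k: "k < card X"
  shows "P (decreasing_rearrangement w X k) \<longleftrightarrow> k < card {x \<in> X. P (w x)}"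
proof -
  define M where "M = image_mset w (mset_set X)"
  have fin: "finite X"
    using k card_ge_0_finite by force
  have size: "size M = card X" "length (sorted_list_of_multiset M) = card X"
    by (simp_all add: M_def flip: size_mset)
  have "{#y \<in># M. \<not> P y#} = image_mset w (mset_set {x \<in> X. \<not> P (w x)})"
    using fin by (simp add: M_def filter_mset_image_mset)
  then have "size {#y \<in># M. \<not> P y#} = card {x \<in> X. \<not> P (w x)}"
    by simp
  also have "\<dots> = card (X - {x \<in> X. P (w x)})"
    by (rule arg_cong[where f = card]) auto
  also have "\<dots> = card X - card {x \<in> X. P (w x)}"
    using fin by (intro card_Diff_subset) auto
  finally have "size {#y \<in># M. \<not> P y#} = card X - card {x \<in> X. P (w x)}" .
  moreover have "card {x \<in> X. P (w x)} \<le> card X"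
    using fin by (intro card_mono) auto
  moreover have "decreasing_rearrangement w X k = sorted_list_of_multiset M ! (card X - Suc k)"
    using k by (simp add: decreasing_rearrangement_def M_def[symmetric] rev_nth size)
  ultimately show ?thesis
    using nth_sorted_list_of_multiset_iff[OF \<open>mono P\<close>, of "card X - Suc k" M] k
    by (auto simp: size)
qed

lemma le_decreasing_rearrangement_iff:
  "k < card X \<Longrightarrow> v \<le> decreasing_rearrangement w X k \<longleftrightarrow> k < card {x \<in> X. v \<le> w x}"
  by (rule decreasing_rearrangement_iff) (auto simp: mono_def)

lemma less_decreasing_rearrangement_iff:
  "k < card X \<Longrightarrow> v < decreasing_rearrangement w X k \<longleftrightarrow> k < card {x \<in> X. v < w x}"
  by (rule decreasing_rearrangement_iff) (auto simp: mono_def)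

lemma card_gt_decreasing_rearrangement_le:
  assumes "finite X"
  shows "card {x \<in> X. decreasing_rearrangement w X k < w x} \<le> k"
proof (cases "k < card X")
  case True
  then show ?thesis
    using less_decreasing_rearrangement_iff[of k X "decreasing_rearrangement w X k" w] by simp
next
  case False
  then show ?thesis
    using card_mono[OF assms, of "{x \<in> X. decreasing_rearrangement w X k < w x}"] by auto
qed

lemma less_card_ge_decreasing_rearrangement:
  "k < card X \<Longrightarrow> k < card {x \<in> X. decreasing_rearrangement w X k \<le> w x}"
  using le_decreasing_rearrangement_iff[of k X "decreasing_rearrangement w X k" w] by simp

lemma decreasing_rearrangement_nonneg:
  assumes "\<And>x. x \<in> X \<Longrightarrow> 0 \<le> w x"
  shows "0 \<le> decreasing_rearrangement w X k"
proof (cases "k < card X")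
  case True
  moreover have "{x \<in> X. 0 \<le> w x} = X"
    using assms by auto
  ultimately show ?thesis
    by (simp add: le_decreasing_rearrangement_iff)
qed (simp add: decreasing_rearrangement_zero)

lemma antimono_decreasing_rearrangement:
  assumes "\<And>x. x \<in> X \<Longrightarrow> 0 \<le> w x"
  shows "antimono (decreasing_rearrangement w X)"
proof (rule antimonoI)
  fix i j :: nat assume "i \<le> j"
  show "decreasing_rearrangement w X j \<le> decreasing_rearrangement w X i"
  proof (cases "j < card X")
    case True
    then show ?thesis
      using less_card_ge_decreasing_rearrangement[OF True, of w] \<open>i \<le> j\<close>
      by (simp add: le_decreasing_rearrangement_iff)
  next
    case False
    then show ?thesis
      using decreasing_rearrangement_nonneg[OF assms] by (simp add: decreasing_rearrangement_zero)
  qed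
qed

lemma sum_decreasing_rearrangement:
  "(\<Sum>k<card X. decreasing_rearrangement w X k) = sum w X"
proof -
  define ws where "ws = rev (sorted_list_of_multiset (image_mset w (mset_set X)))"
  have ws: "mset ws = image_mset w (mset_set X)"
    by (simp add: ws_def)
  then have "length ws = card X"
    by (metis size_image_mset size_mset size_mset_set)
  then have "(\<Sum>k<card X. decreasing_rearrangement w X k) = sum_list ws"
    by (simp add: decreasing_rearrangement_def sum_list_sum_nth lessThan_atLeast0 flip: ws_def)
  also have "\<dots> = sum w X"
    by (simp add: ws sum_unfold_sum_mset flip: sum_mset_sum_list)
  finally show ?thesis .
qed

lemma decreasing_rearrangement_0:
  assumes "finite X" "X \<noteq> {}"
  shows "decreasing_rearrangement w X 0 = Max (w ` X)"
proof (rule antisym)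
  have card_pos: "0 < card X"
    using assms by (simp add: card_gt_0_iff)
  then obtain x where x: "x \<in> X" "decreasing_rearrangement w X 0 \<le> w x"
    using less_card_ge_decreasing_rearrangement[of 0 X w] by (auto simp: card_gt_0_iff)
  have "w x \<le> Max (w ` X)"
    using assms x by simp
  with x(2) show "decreasing_rearrangement w X 0 \<le> Max (w ` X)"
    by (rule order_trans)
  have "Max (w ` X) \<in> w ` X"
    using assms by (intro Max_in) auto
  then have "{x \<in> X. Max (w ` X) \<le> w x} \<noteq> {}"
    by force
  then show "Max (w ` X) \<le> decreasing_rearrangement w X 0"
    using assms card_pos by (simp add: le_decreasing_rearrangement_iff card_gt_0_iff)
qed

section \<open>Quadrature on a geometric grid\<close>

lemma antimono_on_integrable_on:
  fixes f :: "real \<Rightarrow> real"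
  assumes "antimono_on {a..b} f"
  shows "f integrable_on {a..b}"
proof -
  have "mono_on {a..b} (\<lambda>x. - f x)"
    using assms by (auto simp: monotone_on_def)
  then show ?thesis
    using integrable_on_mono_on integrable_neg_iff by blast
qed

lemma antimono_on_integral_bounds:
  fixes f :: "real \<Rightarrow> real"
  assumes f: "antimono_on {a..b} f" and "a \<le> b"
  shows "(b - a) * f b \<le> integral {a..b} f" "integral {a..b} f \<le> (b - a) * f a"
proof -
  have "integral {a..b} (\<lambda>_. f b) \<le> integral {a..b} f"
    "integral {a..b} f \<le> integral {a..b} (\<lambda>_. f a)"
    by (intro integral_le integrable_const_ivl antimono_on_integrable_on f;
        use f in \<open>auto simp: monotone_on_def\<close>)+
  then show "(b - a) * f b \<le> integral {a..b} f" "integral {a..b} f \<le> (b - a) * f a"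
    using \<open>a \<le> b\<close> by auto
qed

lemma antimono_on_integral_extend_bounds:
  fixes f :: "real \<Rightarrow> real"
  assumes f: "antimono_on {0..} f" and "0 \<le> a" "a \<le> b"
  shows "integral {0..a} f + (b - a) * f b \<le> integral {0..b} f"
    and "integral {0..b} f \<le> integral {0..a} f + (b - a) * f a"
proof -
  have "integral {0..b} f = integral {0..a} f + integral {a..b} f"
    using \<open>0 \<le> a\<close> \<open>a \<le> b\<close>
    by (intro Henstock_Kurzweil_Integration.integral_combine[symmetric]
        antimono_on_integrable_on monotone_on_subset[OF f]) auto
  moreover have "antimono_on {a..b} f"
    using \<open>0 \<le> a\<close> by (intro monotone_on_subset[OF f]) auto
  ultimately show "integral {0..a} f + (b - a) * f b \<le> integral {0..b} f"
    "integral {0..b} f \<le> integral {0..a} f + (b - a) * f a"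
    using antimono_on_integral_bounds \<open>a \<le> b\<close> by auto
qed

lemma geometric_lower_quadrature:
  fixes f :: "real \<Rightarrow> real"
  assumes f: "antimono_on {0..} f" and "1 \<le> Q"
    and M: "\<And>i. i < L \<Longrightarrow> M i \<le> f (Q ^ i / Q)"
  shows "f (1 / Q\<^sup>2) + (Q - 1) * (\<Sum>i<L. M i * Q ^ i) \<le> Q\<^sup>2 * integral {0..Q ^ L / Q\<^sup>2} f"
  using M
proof (induction L)
  case 0
  have "integral {0..0} f + (1 / Q\<^sup>2 - 0) * f (1 / Q\<^sup>2) \<le> integral {0..1 / Q\<^sup>2} f"
    by (rule antimono_on_integral_extend_bounds[OF f]) auto
  then show ?case
    using \<open>1 \<le> Q\<close> by (simp add: field_simps)
next
  case (Suc L)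
  define a b where "a = Q ^ L / Q\<^sup>2" and "b = Q ^ L / Q"
  have grid_step: "0 \<le> a" "a \<le> b" "Q\<^sup>2 * (b - a) = (Q - 1) * Q ^ L" "Q ^ Suc L / Q\<^sup>2 = b"
    using \<open>1 \<le> Q\<close> by (auto simp: a_def b_def field_simps power2_eq_square)
  have "(Q - 1) * Q ^ L * M L \<le> (Q - 1) * Q ^ L * f b"
    using Suc.prems[of L] \<open>1 \<le> Q\<close> by (intro mult_left_mono) (auto simp: b_def)
  also have "\<dots> = Q\<^sup>2 * ((b - a) * f b)"
    by (simp flip: grid_step(3))
  also have "\<dots> \<le> Q\<^sup>2 * (integral {0..b} f - integral {0..a} f)"
    using antimono_on_integral_extend_bounds(1)[OF f grid_step(1,2)] by (intro mult_left_mono) auto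
  finally show ?case
    using Suc unfolding grid_step(4) by (simp add: a_def algebra_simps)
qed

lemma geometric_upper_quadrature:
  fixes f :: "real \<Rightarrow> real"
  assumes f: "antimono_on {0..} f" and "1 \<le> Q"
    and M: "\<And>i. i < L \<Longrightarrow> f (Q ^ (i + 2)) \<le> M i"
  shows "integral {0..Q ^ (L + 2)} f \<le> Q\<^sup>2 * (f 0 + (Q - 1) * (\<Sum>i<L. M i * Q ^ i))"
  using M
proof (induction L)
  case 0
  have "integral {0..Q\<^sup>2} f \<le> integral {0..0} f + (Q\<^sup>2 - 0) * f 0"
    by (rule antimono_on_integral_extend_bounds[OF f]) auto
  then show ?case
    by (simp add: power2_eq_square)
next
  case (Suc L)
  define a b where "a = Q ^ (L + 2)" and "b = Q ^ (Suc L + 2)"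
  have grid_step: "0 \<le> a" "a \<le> b" "b - a = Q\<^sup>2 * (Q - 1) * Q ^ L"
    using \<open>1 \<le> Q\<close> by (auto simp: a_def b_def field_simps power2_eq_square intro: mult_right_mono)
  have "integral {0..b} f \<le> integral {0..a} f + (b - a) * f a"
    by (rule antimono_on_integral_extend_bounds[OF f grid_step(1,2)])
  also have "(b - a) * f a \<le> (b - a) * M L"
    using Suc.prems[of L] grid_step by (intro mult_left_mono) (auto simp: a_def)
  finally show ?case
    using Suc unfolding grid_step(3) by (simp add: a_def b_def algebra_simps)
qed

lemma antimono_on_comp_floor:
  fixes s :: "nat \<Rightarrow> real"
  assumes "antimono s"
  shows "antimono_on A (\<lambda>x. s (nat \<lfloor>x :: real\<rfloor>))"
  by (intro monotone_onI antimonoD[OF assms] nat_mono floor_mono)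

lemma has_integral_floor_sum:
  fixes s :: "nat \<Rightarrow> real"
  shows "((\<lambda>x. s (nat \<lfloor>x\<rfloor>)) has_integral (\<Sum>k<N. s k)) {0..real N}"
proof (induction N)
  case (Suc N)
  have "((\<lambda>x. s (nat \<lfloor>x\<rfloor>)) has_integral s N) {real N..real (Suc N)}"
  proof (rule has_integral_spike_finite)
    show "((\<lambda>_. s N) has_integral s N) {real N..real (Suc N)}"
      using has_integral_const_real[of "s N" "real N" "real (Suc N)"] by simp
    show "s (nat \<lfloor>x\<rfloor>) = s N" if "x \<in> {real N..real (Suc N)} - {real (Suc N)}" for x
    proof -
      have "\<lfloor>x\<rfloor> = int N"
        using that by (intro floor_unique) auto
      then show ?thesis
        by simp
    qed
  qed simp
  from has_integral_combine[OF _ _ Suc this] show ?case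
    by simp
qed (simp add: has_integral_refl)

lemma integral_floor_bounds:
  fixes s :: "nat \<Rightarrow> real"
  assumes anti: "antimono s" and zero: "\<And>k. N \<le> k \<Longrightarrow> s k = 0" and "0 \<le> x"
  shows "integral {0..x} (\<lambda>t. s (nat \<lfloor>t\<rfloor>)) \<le> (\<Sum>k<N. s k)"
    and "real N \<le> x \<Longrightarrow> (\<Sum>k<N. s k) \<le> integral {0..x} (\<lambda>t. s (nat \<lfloor>t\<rfloor>))"
proof -
  define f where "f t = s (nat \<lfloor>t\<rfloor>)" for t :: real
  have f: "antimono_on {0..} f"
    unfolding f_def by (rule antimono_on_comp_floor[OF anti])
  have f_zero: "f t = 0" if "real N \<le> t" for t
    using that by (auto simp: f_def le_nat_floor intro: zero)
  have f_sum: "integral {0..real N} f = (\<Sum>k<N. s k)"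
    using has_integral_floor_sum unfolding f_def by (rule integral_unique)
  show "integral {0..x} f \<le> (\<Sum>k<N. s k)"
  proof (cases "x \<le> real N")
    case True
    then show ?thesis
      using antimono_on_integral_extend_bounds(1)[OF f, of x "real N"] \<open>0 \<le> x\<close>
      by (simp add: f_sum f_zero)
  next
    case False
    then show ?thesis
      using antimono_on_integral_extend_bounds(2)[OF f, of "real N" x] by (simp add: f_sum f_zero)
  qed
  show "(\<Sum>k<N. s k) \<le> integral {0..x} f" if "real N \<le> x"
    using antimono_on_integral_extend_bounds(1)[OF f, of "real N" x] that
    by (simp add: f_sum f_zero)
qed

section \<open>Second moments and majority votes\<close>

lemma (in prob_space) second_moment_inequality:
  fixes X :: "'a \<Rightarrow> real"
  assumes X: "integrable M X" and X2: "integrable M (\<lambda>x. (X x)\<^sup>2)"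
  shows "(expectation X)\<^sup>2 \<le> prob {x \<in> space M. X x \<noteq> 0} * expectation (\<lambda>x. (X x)\<^sup>2)"
proof -
  define m v A where "m = expectation X" and "v = expectation (\<lambda>x. (X x)\<^sup>2)"
    and "A = {x \<in> space M. X x \<noteq> 0}"
  have A: "A \<in> events"
    unfolding A_def using borel_measurable_integrable[OF X] by measurable
  then have int_A: "integrable M (indicat_real A)"
    by (simp add: integrable_indicator_iff emeasure_eq_measure)
  have quadratic: "0 \<le> prob A - 2 * u * m + u\<^sup>2 * v" for u
  proof -
    have "0 \<le> expectation (\<lambda>x. (indicator A x - u * X x)\<^sup>2)"
      by (rule integral_nonneg_AE) simp
    also have "\<dots> = expectation (\<lambda>x. indicator A x - 2 * u * X x + u\<^sup>2 * (X x)\<^sup>2)"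
      by (intro Bochner_Integration.integral_cong)
         (auto simp: A_def indicator_def power2_eq_square algebra_simps)
    also have "\<dots> = prob A - 2 * u * m + u\<^sup>2 * v"
      using X X2 int_A A by (simp add: m_def v_def)
    finally show ?thesis .
  qed
  have "m\<^sup>2 \<le> prob A * v"
  proof (cases "v = 0")
    case True
    have "m = 0"
    proof (rule ccontr)
      assume "m \<noteq> 0"
      then show False
        using quadratic[of "(prob A + 1) / (2 * m)"] True by simp
    qed
    then show ?thesis
      using True by simp
  next
    case False
    moreover have "v \<ge> 0"
      unfolding v_def by (rule integral_nonneg_AE) simp
    ultimately show ?thesis
      using quadratic[of "m / v"] by (simp add: field_simps power2_eq_square)
  qed
  then show ?thesis
    by (simp add: m_def v_def A_def)
qed

lemma (in prob_space) prob_eq_zero_le_second_moment: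
  fixes X :: "'a \<Rightarrow> real"
  assumes X: "integrable M X" and X2: "integrable M (\<lambda>x. (X x)\<^sup>2)"
    and nonneg: "0 \<le> expectation X"
    and second_moment_le: "expectation (\<lambda>x. (X x)\<^sup>2) \<le> expectation X * (1 + expectation X)"
  shows "prob {x \<in> space M. X x = 0} \<le> 1 / (1 + expectation X)"
proof -
  define m p where "m = expectation X" and "p = prob {x \<in> space M. X x \<noteq> 0}"
  have "m\<^sup>2 \<le> p * expectation (\<lambda>x. (X x)\<^sup>2)"
    unfolding m_def p_def by (rule second_moment_inequality[OF X X2])
  also have "\<dots> \<le> p * (m * (1 + m))"
    using second_moment_le by (intro mult_left_mono) (simp_all add: m_def p_def)
  finally have "m * m \<le> m * (p * (1 + m))"
    by (simp add: power2_eq_square mult.left_commute)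
  then have "m \<le> p * (1 + m)"
    using nonneg by (cases "m = 0") (auto simp: m_def p_def)
  moreover have "{x \<in> space M. X x \<noteq> 0} \<in> events"
    using borel_measurable_integrable[OF X] by measurable
  moreover have "{x \<in> space M. X x = 0} = space M - {x \<in> space M. X x \<noteq> 0}"
    by auto
  ultimately have "prob {x \<in> space M. X x = 0} * (1 + m) \<le> 1"
    by (simp add: prob_compl p_def algebra_simps)
  then show ?thesis
    using nonneg by (simp add: le_divide_eq m_def)
qed

lemma (in prob_space) prob_none_pairwise_uncorrelated_le:
  assumes "finite T" and E: "\<And>s. s \<in> T \<Longrightarrow> E s \<in> events"
    and pair: "\<And>s t. s \<in> T \<Longrightarrow> t \<in> T \<Longrightarrow> s \<noteq> t \<Longrightarrow> prob (E s \<inter> E t) \<le> prob (E s) * prob (E t)"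
  shows "prob {x \<in> space M. \<forall>s\<in>T. x \<notin> E s} \<le> 1 / (1 + (\<Sum>s\<in>T. prob (E s)))"
proof -
  define X where "X x = (\<Sum>s\<in>T. indicat_real (E s) x)" for x
  define m where "m = (\<Sum>s\<in>T. prob (E s))"
  have int: "integrable M (indicat_real A)" if "A \<in> events" for A
    using that by (simp add: integrable_indicator_iff emeasure_eq_measure)
  have square: "(X x)\<^sup>2 = (\<Sum>s\<in>T. \<Sum>t\<in>T. indicat_real (E s \<inter> E t) x)" for x
    by (simp add: X_def power2_eq_square sum_product indicator_inter_arith)
  have X: "integrable M X" "expectation X = m"
    unfolding X_def m_def using E int by (simp_all add: Bochner_Integration.integral_sum)
  have X2: "integrable M (\<lambda>x. (X x)\<^sup>2)"
    unfolding square using E int by (simp add: sets.Int)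
  have "expectation (\<lambda>x. (X x)\<^sup>2) = (\<Sum>s\<in>T. \<Sum>t\<in>T. prob (E s \<inter> E t))"
    unfolding square using E int by (simp add: Bochner_Integration.integral_sum sets.Int)
  also have "\<dots> \<le> (\<Sum>s\<in>T. \<Sum>t\<in>T. (if t = s then prob (E s) else 0) + prob (E s) * prob (E t))"
    using pair by (intro sum_mono) auto
  also have "\<dots> = m * (1 + m)"
    using \<open>finite T\<close> by (simp add: m_def sum.distrib sum_product algebra_simps)
  finally have "prob {x \<in> space M. X x = 0} \<le> 1 / (1 + m)"
    using prob_eq_zero_le_second_moment[OF X(1) X2] X(2) by (simp add: m_def sum_nonneg)
  moreover have "{x \<in> space M. X x = 0} = {x \<in> space M. \<forall>s\<in>T. x \<notin> E s}"
    using \<open>finite T\<close> by (auto simp: X_def sum_nonneg_eq_0_iff indicator_eq_0_iff)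
  ultimately show ?thesis
    by (simp add: m_def)
qed

lemma (in prob_space) expectation_of_bool:
  "expectation (\<lambda>x. of_bool (P x)) = prob {x \<in> space M. P x}"
proof -
  have "expectation (\<lambda>x. of_bool (P x)) = expectation (indicator {x \<in> space M. P x})"
    by (intro Bochner_Integration.integral_cong) (auto simp: indicator_def)
  also have "\<dots> = prob ({x \<in> space M. P x} \<inter> space M)"
    by simp
  also have "{x \<in> space M. P x} \<inter> space M = {x \<in> space M. P x}"
    by auto
  finally show ?thesis .
qed

lemma (in prob_space) prob_fraction_of_indep_ge_le:
  fixes P :: "'i \<Rightarrow> 'a \<Rightarrow> bool"
  assumes J: "finite J" "J \<noteq> {}" and indep: "indep_vars (\<lambda>_. count_space UNIV) P J"
    and rare: "\<And>j. j \<in> J \<Longrightarrow> prob {x \<in> space M. P j x} \<le> \<rho>" and "\<rho> \<le> \<theta>"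
  shows "prob {x \<in> space M. \<theta> * real (card J) \<le> real (card {j \<in> J. P j x})}
    \<le> exp (- 2 * (\<theta> - \<rho>)\<^sup>2 * real (card J))"
proof -
  define X where "X j x = (of_bool (P j x) :: real)" for j x
  define \<mu> where "\<mu> = (\<Sum>j\<in>J. expectation (X j))"
  define N where "N = real (card J)"
  have "N > 0"
    using J by (simp add: N_def card_gt_0_iff)
  have "indep_vars (\<lambda>_. borel) X J"
    unfolding X_def by (rule indep_vars_compose2[OF indep]) auto
  then interpret Hoeffding_ineq M J X "\<lambda>_. 0" "\<lambda>_. 1" \<mu>
    by unfold_locales (use J in \<open>auto simp: X_def \<mu>_def\<close>)
  have "expectation (X j) \<le> \<rho>" if "j \<in> J" for j
    unfolding X_def expectation_of_bool by (rule rare[OF that])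
  then have "\<mu> \<le> \<rho> * N"
    using sum_bounded_above[of J "\<lambda>j. expectation (X j)" \<rho>]
    by (simp add: \<mu>_def N_def mult.commute)
  then have deviation_ge: "(\<theta> - \<rho>) * N \<le> \<theta> * N - \<mu>"
    by (simp add: algebra_simps)
  have "0 \<le> (\<theta> - \<rho>) * N"
    using \<open>\<rho> \<le> \<theta>\<close> by (simp add: N_def)
  have card_eq_sum: "real (card {j \<in> J. P j x}) = (\<Sum>j\<in>J. X j x)" for x
    using J by (simp add: X_def Int_def)
  have "prob {x \<in> space M. \<theta> * N \<le> real (card {j \<in> J. P j x})} =
      prob {x \<in> space M. \<mu> + (\<theta> * N - \<mu>) \<le> (\<Sum>j\<in>J. X j x)}"
    by (simp add: card_eq_sum)
  also have "\<dots> \<le> exp (- 2 * (\<theta> * N - \<mu>)\<^sup>2 / N)"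
    using Hoeffding_ineq_ge[of "\<theta> * N - \<mu>"] deviation_ge \<open>0 \<le> (\<theta> - \<rho>) * N\<close> \<open>N > 0\<close>
    by (simp add: N_def)
  also have "\<dots> \<le> exp (- 2 * ((\<theta> - \<rho>) * N)\<^sup>2 / N)"
    using power_mono[OF deviation_ge \<open>0 \<le> (\<theta> - \<rho>) * N\<close>, of 2] \<open>N > 0\<close>
    by (simp add: divide_right_mono)
  also have "\<dots> = exp (- 2 * (\<theta> - \<rho>)\<^sup>2 * N)"
    using \<open>N > 0\<close> by (simp add: power_mult_distrib power2_eq_square)
  finally show ?thesis
    by (simp add: N_def)
qed

lemma prob_Pi_pmf_majority_le:
  fixes p :: "'i \<Rightarrow> 'a pmf"
  assumes I: "finite I" "J \<subseteq> I" and "\<rho> \<le> 1 / 2"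
    and rare: "\<And>j. j \<in> J \<Longrightarrow> measure_pmf.prob (p j) {x. P x} \<le> \<rho>"
  shows "measure_pmf.prob (Pi_pmf I d p) {S. card J \<le> 2 * card {j \<in> J. P (S j)}}
    \<le> exp (- 2 * (1 / 2 - \<rho>)\<^sup>2 * real (card J))"
proof (cases "J = {}")
  case False
  have "prob_space.indep_vars (Pi_pmf I d p) (\<lambda>_. count_space UNIV) (\<lambda>j S. S j) J"
    using indep_vars_Pi_pmf[OF I(1)] I(2)
    by (rule prob_space.indep_vars_subset[OF measure_pmf.prob_space_axioms])
  then have "prob_space.indep_vars (Pi_pmf I d p) (\<lambda>_. count_space UNIV) (\<lambda>j S. P (S j)) J"
    by (rule prob_space.indep_vars_compose2[OF measure_pmf.prob_space_axioms]) auto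
  moreover have "measure_pmf.prob (Pi_pmf I d p) {S. P (S j)} \<le> \<rho>" if "j \<in> J" for j
  proof -
    have "measure_pmf.prob (Pi_pmf I d p) {S. P (S j)} =
        measure_pmf.prob (map_pmf (\<lambda>S. S j) (Pi_pmf I d p)) {x. P x}"
      by (simp add: vimage_def)
    also have "map_pmf (\<lambda>S. S j) (Pi_pmf I d p) = p j"
      using that I by (auto simp: Pi_pmf_component)
    finally show ?thesis
      using rare[OF that] by simp
  qed
  ultimately have "measure_pmf.prob (Pi_pmf I d p)
      {S. 1 / 2 * real (card J) \<le> real (card {j \<in> J. P (S j)})}
      \<le> exp (- 2 * (1 / 2 - \<rho>)\<^sup>2 * real (card J))"
    using measure_pmf.prob_fraction_of_indep_ge_le[of J "Pi_pmf I d p" "\<lambda>j S. P (S j)" \<rho> "1 / 2"]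
      False I \<open>\<rho> \<le> 1 / 2\<close> by (simp add: finite_subset)
  moreover have "1 / 2 * real a \<le> real b \<longleftrightarrow> a \<le> 2 * b" for a b :: nat
    by linarith
  ultimately show ?thesis
    by (simp only:)
qed simp

lemma
  fixes p :: "'i \<Rightarrow> 'a pmf" and f :: "'a \<Rightarrow> real"
  assumes I: "finite I" "set js \<subseteq> I" "distinct js" and \<rho>: "\<rho> \<le> 1 / 2"
  shows prob_Pi_pmf_median_gt:
      "(\<And>j. j \<in> set js \<Longrightarrow> measure_pmf.prob (p j) {x. v < f x} \<le> \<rho>) \<Longrightarrow>
      measure_pmf.prob (Pi_pmf I d p) {S. v < median (map (\<lambda>j. f (S j)) js)}
        \<le> exp (- 2 * (1 / 2 - \<rho>)\<^sup>2 * real (length js))"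
    and prob_Pi_pmf_median_lt:
      "(\<And>j. j \<in> set js \<Longrightarrow> measure_pmf.prob (p j) {x. f x < v} \<le> \<rho>) \<Longrightarrow>
      measure_pmf.prob (Pi_pmf I d p) {S. median (map (\<lambda>j. f (S j)) js) < v}
        \<le> exp (- 2 * (1 / 2 - \<rho>)\<^sup>2 * real (length js))"
proof -
  have count: "length (filter P (map (\<lambda>j. f (S j)) js)) = card {j \<in> set js. P (f (S j))}" for P S
    using I(3) by (simp add: filter_map distinct_length_filter o_def Int_def conj_commute)
  have card_js: "card (set js) = length js"
    using I(3) by (rule distinct_card)
  note majority = prob_Pi_pmf_majority_le[OF I(1,2) \<rho>, of p _ d, unfolded card_js]
  show "measure_pmf.prob (Pi_pmf I d p) {S. v < median (map (\<lambda>j. f (S j)) js)}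
      \<le> exp (- 2 * (1 / 2 - \<rho>)\<^sup>2 * real (length js))"
    if "\<And>j. j \<in> set js \<Longrightarrow> measure_pmf.prob (p j) {x. v < f x} \<le> \<rho>"
    by (intro order_trans[OF measure_pmf.finite_measure_mono majority[OF that]])
       (auto simp: count simp del: length_filter_map dest!: median_gt_imp_half)
  show "measure_pmf.prob (Pi_pmf I d p) {S. median (map (\<lambda>j. f (S j)) js) < v}
      \<le> exp (- 2 * (1 / 2 - \<rho>)\<^sup>2 * real (length js))"
    if "\<And>j. j \<in> set js \<Longrightarrow> measure_pmf.prob (p j) {x. f x < v} \<le> \<rho>"
    by (intro order_trans[OF measure_pmf.finite_measure_mono majority[OF that]])
       (auto simp: count simp del: length_filter_map dest!: median_lt_imp_half)
qed

section \<open>The heaviest survivor of a random subset\<close>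

definition max_weight :: "('a \<Rightarrow> real) \<Rightarrow> 'a set \<Rightarrow> real" where
  "max_weight w S = (if S = {} then 0 else Max (w ` S))"

lemma less_max_weight_iff:
  assumes "finite S" "0 \<le> v"
  shows "v < max_weight w S \<longleftrightarrow> (\<exists>x\<in>S. v < w x)"
  using assms by (auto simp: max_weight_def Max_gr_iff)

lemma le_max_weight: "finite S \<Longrightarrow> x \<in> S \<Longrightarrow> w x \<le> max_weight w S"
  by (auto simp: max_weight_def)

lemma max_weight_nonneg:
  assumes "finite S" "\<And>x. x \<in> S \<Longrightarrow> 0 \<le> w x"
  shows "0 \<le> max_weight w S"
  using assms by (auto simp: max_weight_def Max_ge_iff)

lemma prob_max_weight_gt_rearrangement:
  fixes p :: "'b pmf" and E :: "'a \<Rightarrow> 'b set"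
  assumes "finite X" and w: "\<And>x. x \<in> X \<Longrightarrow> 0 \<le> w x"
    and \<rho>: "0 \<le> \<rho>" "\<And>x. x \<in> X \<Longrightarrow> measure_pmf.prob p (E x) \<le> \<rho>"
  shows "measure_pmf.prob p
      {y. decreasing_rearrangement w X k < max_weight w {x \<in> X. y \<in> E x}} \<le> real k * \<rho>"
proof -
  define T where "T = {x \<in> X. decreasing_rearrangement w X k < w x}"
  have "{y. decreasing_rearrangement w X k < max_weight w {x \<in> X. y \<in> E x}} = (\<Union>x\<in>T. E x)"
    using \<open>finite X\<close> decreasing_rearrangement_nonneg[of X w k, OF w]
    by (auto simp: T_def less_max_weight_iff)
  also have "measure_pmf.prob p \<dots> \<le> (\<Sum>x\<in>T. measure_pmf.prob p (E x))"
    using \<open>finite X\<close>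
    by (intro measure_pmf.finite_measure_subadditive_finite) (auto simp: T_def)
  also have "\<dots> \<le> real (card T) * \<rho>"
    using \<rho>(2) by (intro sum_bounded_above) (auto simp: T_def)
  also have "\<dots> \<le> real k * \<rho>"
    using card_gt_decreasing_rearrangement_le[OF \<open>finite X\<close>, of w k] \<rho>(1)
    by (intro mult_right_mono) (auto simp: T_def)
  finally show ?thesis .
qed

lemma prob_max_weight_lt_rearrangement:
  fixes p :: "'b pmf" and E :: "'a \<Rightarrow> 'b set"
  assumes "finite X" and w: "\<And>x. x \<in> X \<Longrightarrow> 0 \<le> w x"
    and \<rho>: "0 \<le> \<rho>" "\<And>x. x \<in> X \<Longrightarrow> measure_pmf.prob p (E x) = \<rho>"
    and pair: "\<And>x y. x \<in> X \<Longrightarrow> y \<in> X \<Longrightarrow> x \<noteq> y \<Longrightarrow> measure_pmf.prob p (E x \<inter> E y) = \<rho>\<^sup>2"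
  shows "measure_pmf.prob p
      {y. max_weight w {x \<in> X. y \<in> E x} < decreasing_rearrangement w X k}
    \<le> 1 / (1 + real (Suc k) * \<rho>)"
proof (cases "k < card X")
  case True
  define T where "T = {x \<in> X. decreasing_rearrangement w X k \<le> w x}"
  have T: "finite T" "Suc k \<le> card T"
    using \<open>finite X\<close> less_card_ge_decreasing_rearrangement[OF True, of w] by (auto simp: T_def)
  have "y \<notin> E x"
    if "max_weight w {x \<in> X. y \<in> E x} < decreasing_rearrangement w X k" "x \<in> T" for x y
    using that \<open>finite X\<close> le_max_weight[of "{x \<in> X. y \<in> E x}" x w] by (fastforce simp: T_def)
  then have "measure_pmf.prob p
      {y. max_weight w {x \<in> X. y \<in> E x} < decreasing_rearrangement w X k}
    \<le> measure_pmf.prob p {y \<in> space p. \<forall>x\<in>T. y \<notin> E x}"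
    by (intro measure_pmf.finite_measure_mono) auto
  also have "\<dots> \<le> 1 / (1 + (\<Sum>x\<in>T. measure_pmf.prob p (E x)))"
    using T(1) \<rho>(2) pair
    by (intro measure_pmf.prob_none_pairwise_uncorrelated_le) (auto simp: T_def power2_eq_square)
  also have "(\<Sum>x\<in>T. measure_pmf.prob p (E x)) = real (card T) * \<rho>"
    using \<rho>(2) by (simp add: T_def)
  also have "1 / (1 + real (card T) * \<rho>) \<le> 1 / (1 + real (Suc k) * \<rho>)"
    using \<rho>(1) T(2) by (intro divide_left_mono add_left_mono mult_right_mono)
      (auto intro!: mult_pos_pos add_pos_nonneg)
  finally show ?thesis .
next
  case False
  have "0 \<le> max_weight w {x \<in> X. y \<in> E x}" for y
    using \<open>finite X\<close> w by (intro max_weight_nonneg) auto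
  then have "{y. max_weight w {x \<in> X. y \<in> E x} < decreasing_rearrangement w X k} = {}"
    using False by (auto simp: decreasing_rearrangement_zero not_less)
  then show ?thesis
    using \<rho>(1) by simp
qed

section \<open>Random affine maps over a finite field\<close>

lemma bij_betw_vec_PiE_dflt:
  "bij_betw (Matrix.vec m) (PiE_dflt {0..<m} 0 (\<lambda>_. UNIV)) (carrier_vec m)"
  by (rule bij_betw_byWitness[where f' = "\<lambda>v i. if i < m then v $ i else 0"])
     (auto simp: PiE_dflt_def fun_eq_iff)

lemma bij_betw_mat_PiE_dflt:
  "bij_betw (Matrix.mat m n) (PiE_dflt ({0..<m} \<times> {0..<n}) 0 (\<lambda>_. UNIV)) (carrier_mat m n)"
  by (rule bij_betw_byWitness[where f' = "\<lambda>A (i, j). if i < m \<and> j < n then A $$ (i, j) else 0"])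
     (auto simp: PiE_dflt_def fun_eq_iff)

lemma finite_carrier_vec: "finite (carrier_vec m :: 'f::{zero,finite} Matrix.vec set)"
  by (rule bij_betw_finite[OF bij_betw_vec_PiE_dflt, THEN iffD1]) auto

lemma finite_carrier_mat: "finite (carrier_mat m n :: 'f::{zero,finite} mat set)"
  by (rule bij_betw_finite[OF bij_betw_mat_PiE_dflt, THEN iffD1]) auto

lemma uniform_vec_eq_pmf_of_set: "uniform_vec m = pmf_of_set (carrier_vec m)"
  unfolding uniform_vec_def
  by (subst Pi_pmf_of_set) (auto intro!: map_pmf_of_set_bij_betw bij_betw_vec_PiE_dflt)

lemma uniform_mat_eq_pmf_of_set: "uniform_mat m n = pmf_of_set (carrier_mat m n)"
  unfolding uniform_mat_def
  by (subst Pi_pmf_of_set) (auto intro!: map_pmf_of_set_bij_betw bij_betw_mat_PiE_dflt)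

lemma set_pmf_uniform_vec: "set_pmf (uniform_vec m) = carrier_vec m"
  unfolding uniform_vec_eq_pmf_of_set
  by (intro set_pmf_of_set finite_carrier_vec) (auto intro: zero_carrier_vec)

lemma set_pmf_uniform_mat: "set_pmf (uniform_mat m n) = carrier_mat m n"
  unfolding uniform_mat_eq_pmf_of_set
  by (intro set_pmf_of_set finite_carrier_mat) (auto intro: zero_carrier_mat)

lemma map_pmf_uniform_vec_add:
  assumes "u \<in> carrier_vec m"
  shows "map_pmf (\<lambda>v. u + v) (uniform_vec m) = uniform_vec m"
  unfolding uniform_vec_eq_pmf_of_set
proof (rule map_pmf_of_set_bij_betw)
  show "bij_betw (\<lambda>v. u + v) (carrier_vec m) (carrier_vec m)"
    by (rule bij_betw_byWitness[where f' = "\<lambda>v. - u + v"]) (use assms in auto)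
qed (auto simp: finite_carrier_vec intro: zero_carrier_vec)

lemma map_pmf_uniform_mat_add:
  assumes "B \<in> carrier_mat m n"
  shows "map_pmf (\<lambda>A. B + A) (uniform_mat m n) = uniform_mat m n"
  unfolding uniform_mat_eq_pmf_of_set
proof (rule map_pmf_of_set_bij_betw)
  show "bij_betw (\<lambda>A. B + A) (carrier_mat m n) (carrier_mat m n)"
    by (rule bij_betw_byWitness[where f' = "\<lambda>A. - B + A"]) (use assms in auto)
qed (auto simp: finite_carrier_mat intro: zero_carrier_mat)

lemma obtain_mult_mat_vec_right_inverse:
  fixes z :: "'f::field Matrix.vec"
  assumes "z \<in> carrier_vec n" "z \<noteq> 0\<^sub>v n"
  obtains B where "\<And>u. B u \<in> carrier_mat m n" "\<And>u. u \<in> carrier_vec m \<Longrightarrow> B u *\<^sub>v z = u"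
proof -
  obtain c where c: "c < n" "z $ c \<noteq> 0"
    using assms by (metis carrier_vecD eq_vecI index_zero_vec)
  define B where "B u = Matrix.mat m n (\<lambda>(i, j). if j = c then u $ i / z $ c else 0)" for u
  have B: "B u \<in> carrier_mat m n" for u
    by (simp add: B_def)
  have "B u *\<^sub>v z = u" if u: "u \<in> carrier_vec m" for u
  proof (rule eq_vecI)
    fix i assume "i < dim_vec u"
    then have "(B u *\<^sub>v z) $ i = (\<Sum>j\<in>{0..<n}. (if j = c then u $ i / z $ c else 0) * z $ j)"
      using assms u by (simp add: B_def scalar_prod_def)
    also have "\<dots> = (\<Sum>j\<in>{0..<n}. if j = c then u $ i / z $ c * z $ j else 0)"
      by (intro sum.cong) auto
    also have "\<dots> = u $ i"
      using c by simp
    finally show "(B u *\<^sub>v z) $ i = u $ i" .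
  qed (use u in \<open>simp add: B_def\<close>)
  with B show thesis
    by (rule that)
qed

text \<open>Adding to \<open>A\<close> an independent random matrix \<open>B u\<close> with \<open>B u z = u\<close> uniform leaves the
  distribution of \<open>A\<close> unchanged, but visibly makes \<open>A z\<close> uniform.\<close>

lemma map_pmf_uniform_mat_mult_vec:
  fixes z :: "'f::{field,finite} Matrix.vec"
  assumes z: "z \<in> carrier_vec n" "z \<noteq> 0\<^sub>v n"
  shows "map_pmf (\<lambda>A. A *\<^sub>v z) (uniform_mat m n) = uniform_vec m"
proof -
  obtain B where B: "\<And>u. B u \<in> carrier_mat m n" "\<And>u. u \<in> carrier_vec m \<Longrightarrow> B u *\<^sub>v z = u"
    using obtain_mult_mat_vec_right_inverse[OF z, of m] by blast
  have shift: "(B u + A) *\<^sub>v z = A *\<^sub>v z + u"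
    if "u \<in> carrier_vec m" "A \<in> carrier_mat m n" for u A
    using add_mult_distrib_mat_vec[OF B(1) that(2) z(1)] that z(1) B(2)[OF that(1)]
    by (simp add: comm_add_vec[OF that(1)])
  have "map_pmf (\<lambda>A. A *\<^sub>v z) (uniform_mat m n) =
      do {u :: 'f Matrix.vec \<leftarrow> uniform_vec m; map_pmf (\<lambda>A. A *\<^sub>v z) (uniform_mat m n)}"
    by simp
  also have "\<dots> = do {u \<leftarrow> uniform_vec m;
      map_pmf (\<lambda>A. A *\<^sub>v z) (map_pmf (\<lambda>A. B u + A) (uniform_mat m n))}"
    by (simp only: map_pmf_uniform_mat_add[OF B(1)])
  also have "\<dots> = do {u \<leftarrow> uniform_vec m; A \<leftarrow> uniform_mat m n; return_pmf ((A *\<^sub>v z) + u)}"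
    unfolding map_pmf_comp unfolding map_pmf_def
    by (intro bind_pmf_cong refl) (auto simp: set_pmf_uniform_vec set_pmf_uniform_mat shift)
  also have "\<dots> = do {A \<leftarrow> uniform_mat m n; map_pmf (\<lambda>u. (A *\<^sub>v z) + u) (uniform_vec m)}"
    by (subst bind_commute_pmf) (simp add: map_pmf_def)
  also have "\<dots> = do {A :: 'f mat \<leftarrow> uniform_mat m n; uniform_vec m}"
    using z(1) by (intro bind_pmf_cong refl map_pmf_uniform_vec_add)
      (auto simp: set_pmf_uniform_mat)
  finally show ?thesis
    by simp
qed

lemma map_pmf_uniform_affine:
  fixes x :: "'f::{field,finite} Matrix.vec"
  assumes "x \<in> carrier_vec n"
  shows "map_pmf (\<lambda>(A, b). A *\<^sub>v x + b) (pair_pmf (uniform_mat m n) (uniform_vec m)) =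
    uniform_vec m"
proof -
  have "map_pmf (\<lambda>(A, b). A *\<^sub>v x + b) (pair_pmf (uniform_mat m n) (uniform_vec m)) =
      do {A \<leftarrow> uniform_mat m n; map_pmf (\<lambda>b. A *\<^sub>v x + b) (uniform_vec m)}"
    by (simp add: pair_pmf_def map_bind_pmf map_pmf_def bind_return_pmf bind_assoc_pmf)
  also have "\<dots> = do {A :: 'f mat \<leftarrow> uniform_mat m n; uniform_vec m}"
    using assms by (intro bind_pmf_cong refl map_pmf_uniform_vec_add)
      (auto simp: set_pmf_uniform_mat)
  finally show ?thesis
    by simp
qed

lemma bind_uniform_vec_add_mult_vec:
  fixes z :: "'f::{field,finite} Matrix.vec"
  assumes z: "z \<in> carrier_vec n" "z \<noteq> 0\<^sub>v n"
  shows "do {A \<leftarrow> uniform_mat m n; u \<leftarrow> uniform_vec m; return_pmf (u, u + A *\<^sub>v z)} =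
    pair_pmf (uniform_vec m) (uniform_vec m)"
proof -
  have "do {A \<leftarrow> uniform_mat m n; u \<leftarrow> uniform_vec m; return_pmf (u, u + A *\<^sub>v z)} =
      do {u \<leftarrow> uniform_vec m; v \<leftarrow> map_pmf (\<lambda>A. A *\<^sub>v z) (uniform_mat m n);
        return_pmf (u, u + v)}"
    by (subst bind_commute_pmf) (simp add: bind_map_pmf)
  also have "\<dots> = do {u \<leftarrow> uniform_vec m; v \<leftarrow> map_pmf (\<lambda>v. u + v) (uniform_vec m);
        return_pmf (u, v)}"
    unfolding map_pmf_uniform_mat_mult_vec[OF z] by (simp add: bind_map_pmf)
  also have "\<dots> = pair_pmf (uniform_vec m) (uniform_vec m)"
    unfolding pair_pmf_def
    by (intro bind_pmf_cong refl map_pmf_uniform_vec_add) (auto simp: set_pmf_uniform_vec)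
  finally show ?thesis .
qed

text \<open>For fixed \<open>A\<close> the vector \<open>u = A x + b\<close> is as uniform as \<open>b\<close>, and \<open>A y + b = u + A (y - x)\<close>.\<close>

lemma map_pmf_uniform_affine_pair:
  fixes x y :: "'f::{field,finite} Matrix.vec"
  assumes x: "x \<in> carrier_vec n" and y: "y \<in> carrier_vec n" and "x \<noteq> y"
  shows "map_pmf (\<lambda>(A, b). (A *\<^sub>v x + b, A *\<^sub>v y + b))
      (pair_pmf (uniform_mat m n) (uniform_vec m)) =
    pair_pmf (uniform_vec m) (uniform_vec m)"
proof -
  define z where "z = y - x"
  have y_eq: "y = x + z"
    using x y by (intro eq_vecI) (auto simp: z_def)
  have z: "z \<in> carrier_vec n"
    using x y by (simp add: z_def)
  have nonzero: "z \<noteq> 0\<^sub>v n"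
  proof
    assume "z = 0\<^sub>v n"
    with y_eq x \<open>x \<noteq> y\<close> show False
      by simp
  qed
  have split: "A *\<^sub>v y + b = (A *\<^sub>v x + b) + A *\<^sub>v z"
    if "A \<in> carrier_mat m n" "b \<in> carrier_vec m" for A b
    unfolding y_eq mult_add_distrib_mat_vec[OF that(1) x z] using that x z
    by (intro eq_vecI) auto
  have "map_pmf (\<lambda>(A, b). (A *\<^sub>v x + b, A *\<^sub>v y + b))
      (pair_pmf (uniform_mat m n) (uniform_vec m)) =
    do {A \<leftarrow> uniform_mat m n; b \<leftarrow> uniform_vec m;
      return_pmf (A *\<^sub>v x + b, (A *\<^sub>v x + b) + A *\<^sub>v z)}"
    unfolding pair_pmf_def map_bind_pmf map_return_pmf
    by (intro bind_pmf_cong refl) (auto simp: split set_pmf_uniform_mat set_pmf_uniform_vec)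
  also have "\<dots> = do {A \<leftarrow> uniform_mat m n; u \<leftarrow> map_pmf (\<lambda>b. A *\<^sub>v x + b) (uniform_vec m);
      return_pmf (u, u + A *\<^sub>v z)}"
    by (simp add: bind_map_pmf)
  also have "\<dots> = do {A \<leftarrow> uniform_mat m n; u \<leftarrow> uniform_vec m; return_pmf (u, u + A *\<^sub>v z)}"
    using x by (intro bind_pmf_cong refl map_pmf_uniform_vec_add) (auto simp: set_pmf_uniform_mat)
  also have "\<dots> = pair_pmf (uniform_vec m) (uniform_vec m)"
    by (rule bind_uniform_vec_add_mult_vec[OF z nonzero])
  finally show ?thesis .
qed

lemma prob_uniform_vec_all:
  "measure_pmf.prob (uniform_vec m) {u. \<forall>j<m. u $ j \<in> G} =
    (real (card G) / real CARD('f)) ^ m"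
  for G :: "'f::{field,finite} set"
proof -
  have "measure_pmf.prob (uniform_vec m) {u. \<forall>j<m. u $ j \<in> G} =
      measure_pmf.prob (Pi_pmf {0..<m} 0 (\<lambda>_. pmf_of_set UNIV)) (Pi {0..<m} (\<lambda>_. G))"
    by (auto simp: uniform_vec_def Pi_def intro!: arg_cong[where f = "measure_pmf.prob _"])
  then show ?thesis
    by (simp add: measure_Pi_pmf_Pi measure_pmf_of_set)
qed

section \<open>Parameters of the algorithm\<close>

lemma nat_ceiling_le_double: "1 \<le> x \<Longrightarrow> real (nat \<lceil>x\<rceil>) \<le> 2 * x"
  by linarith

lemma wish_calls_eq: "wish_calls n q r \<delta> = wish_levels n q r * wish_reps n q r \<delta>"
  by (simp add: wish_calls_def wish_queries_def card_cartesian_product)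

locale wish_parameters =
  fixes q r :: nat
  assumes r_eq: "r = wish_r q" and r_pos: "r > 0"
begin

abbreviation Q :: real where
  "Q \<equiv> real q / real r"

lemma q_cases: "q = 2 * r + 1 \<or> q = 2 * r + 2"
  using r_eq r_pos unfolding wish_r_def by linarith

lemma real_r_ge_1: "1 \<le> real r"
  using r_pos by simp

lemma real_q_bounds: "2 * real r + 1 \<le> real q" "real q \<le> 2 * real r + 2"
  using q_cases by auto

lemma ratio_bounds: "2 < Q" "Q \<le> 4"
  using real_r_ge_1 real_q_bounds by (simp_all add: field_simps)

lemma inverse_ratio: "1 / Q = real r / real q"
  by simp

lemma wish_gamma_eq: "wish_gamma q r = (real q - 2 * real r)\<^sup>2 / (12 * real r * real q)"
proof -
  have "1 / 2 - real r / real q = (real q - 2 * real r) / (2 * real q)"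
    using real_q_bounds by (simp add: field_simps)
  then show ?thesis
    using real_r_ge_1 real_q_bounds unfolding wish_gamma_def
    by (simp add: field_simps power2_eq_square)
qed

lemma wish_gamma_pos: "0 < wish_gamma q r"
  using real_r_ge_1 real_q_bounds by (simp add: wish_gamma_eq)

lemma wish_gamma_le: "wish_gamma q r \<le> 1 / 12"
proof -
  have "(real q - 2 * real r)\<^sup>2 \<le> real q"
    using q_cases real_r_ge_1 by auto
  also have "\<dots> \<le> real r * real q"
    using real_r_ge_1 by (simp add: mult_le_cancel_right1)
  finally show ?thesis
    using real_r_ge_1 real_q_bounds by (simp add: wish_gamma_eq divide_le_eq)
qed

lemma wish_gamma_le_hoeffding_exponent:
  "(real r + 1) * wish_gamma q r \<le> 2 * (1 / 2 - 1 / (1 + Q))\<^sup>2"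
proof -
  define x where "x = real r"
  have x: "1 \<le> x" "1 \<le> x * x" "1 \<le> x * x * x"
    using real_r_ge_1 mult_mono[of 1 x 1 x] mult_mono[of 1 "x * x" 1 x] by (auto simp: x_def)
  have polynomial: "(x + 1) * (real q - 2 * x)\<^sup>2 * (2 * (real q + x)\<^sup>2) \<le>
      (real q - x)\<^sup>2 * (12 * x * real q)"
    using q_cases
  proof
    assume "q = 2 * r + 1"
    then have q: "real q = 2 * x + 1"
      by (simp add: x_def)
    have "(x + 1) * (3 * x + 1)\<^sup>2 \<le> (x + 1) * (6 * x * (2 * x + 1) * (x + 1))"
      using x by (intro mult_left_mono) (auto simp: power2_eq_square algebra_simps)
    then show ?thesis
      unfolding q by (simp add: power2_eq_square algebra_simps)
  next
    assume "q = 2 * r + 2"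
    then have q: "real q = 2 * x + 2"
      by (simp add: x_def)
    have "4 * (x + 1) * (3 * x + 2)\<^sup>2 \<le> 4 * (x + 1) * (3 * x * (x + 2)\<^sup>2)"
      using x by (intro mult_left_mono) (auto simp: power2_eq_square algebra_simps)
    then show ?thesis
      unfolding q by (simp add: power2_eq_square algebra_simps)
  qed
  have "0 < 12 * x * real q" "0 < 2 * (real q + x)\<^sup>2"
    using x real_q_bounds by (auto simp: x_def)
  then have "(x + 1) * (real q - 2 * x)\<^sup>2 / (12 * x * real q) \<le>
      (real q - x)\<^sup>2 / (2 * (real q + x)\<^sup>2)"
    using polynomial by (simp only: pos_divide_le_eq pos_le_divide_eq times_divide_eq_left)
  also have "\<dots> = 2 * ((real q - x) / (2 * (real q + x)))\<^sup>2"
    by (simp add: power_divide power_mult_distrib del: distrib_left_numeral)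
  also have "(real q - x) / (2 * (real q + x)) = 1 / 2 - 1 / (1 + Q)"
    using x by (simp add: x_def field_simps)
  finally show ?thesis
    by (simp add: wish_gamma_eq x_def)
qed

lemma log_ratio_bounds: "1 \<le> log Q (real q)" "log Q (real q) \<le> real r"
proof -
  have Qr: "Q * real r = real q"
    using r_pos by simp
  have "Q * 1 \<le> Q * real r"
    using ratio_bounds real_r_ge_1 by (intro mult_left_mono) auto
  then show "1 \<le> log Q (real q)"
    using ratio_bounds real_q_bounds real_r_ge_1 unfolding Qr by (subst le_log_iff) auto
  have "r \<le> 2 ^ (r - 1)"
    using r_pos less_exp[of "r - 1"] by linarith
  then have "real r \<le> real (2 ^ (r - 1))"
    by (rule of_nat_mono)
  also have "\<dots> \<le> Q ^ (r - 1)"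
    using ratio_bounds by (auto intro: power_mono)
  finally have "Q * real r \<le> Q * Q ^ (r - 1)"
    using ratio_bounds by (intro mult_left_mono) auto
  also have "\<dots> = Q ^ r"
    using power_minus_mult[OF r_pos, of Q] by (simp add: mult.commute)
  finally have "real q \<le> Q ^ r"
    by (simp only: Qr)
  then have "log Q (real q) \<le> log Q (Q ^ r)"
    using ratio_bounds real_q_bounds by (subst log_le_cancel_iff) auto
  also have "\<dots> = real r"
    using ratio_bounds by (intro log_pow_cancel) auto
  finally show "log Q (real q) \<le> real r" .
qed

lemma wish_levels_le: "wish_levels n q r \<le> n * r"
  using log_ratio_bounds(2) by (simp add: wish_levels_def mult_left_mono)

lemma power_le_power_wish_levels: "real q ^ n \<le> Q ^ wish_levels n q r"
proof -
  have "real q ^ n = (Q powr log Q (real q)) powr real n"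
    using ratio_bounds real_q_bounds by (simp add: powr_realpow)
  also have "\<dots> = Q powr (real n * log Q (real q))"
    by (simp add: powr_powr mult.commute)
  also have "\<dots> \<le> Q powr real (wish_levels n q r)"
    using ratio_bounds unfolding wish_levels_def
    by (intro powr_mono) (auto simp: real_nat_ceiling_ge)
  also have "\<dots> = Q ^ wish_levels n q r"
    using ratio_bounds by (simp add: powr_realpow)
  finally show ?thesis .
qed

lemma fact_le_power_wish_levels:
  assumes "n \<le> q"
  shows "fact n \<le> Q ^ wish_levels n q r"
proof -
  have "fact n \<le> real n ^ n"
    using fact_le_power[of n, where 'a = real] by simp
  also have "\<dots> \<le> real q ^ n"
    using assms by (intro power_mono) auto
  also note power_le_power_wish_levels
  finally show ?thesis .
qed

definition median_error :: "nat \<Rightarrow> real \<Rightarrow> real" where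
  "median_error n \<delta> = exp (- 2 * (1 / 2 - 1 / (1 + Q))\<^sup>2 * real (wish_reps n q r \<delta>))"

lemma median_error_le:
  assumes "n \<ge> 1" "0 < \<delta>" "\<delta> < 1"
  shows "median_error n \<delta> \<le> (\<delta> / (2 * real n)) ^ (r + 1)"
proof -
  define y where "y = ln (2 * real n / \<delta>)"
  have "real (r + 1) * y = (real r + 1) * wish_gamma q r * (1 / wish_gamma q r * y)"
    using wish_gamma_pos by simp
  also have "\<dots> \<le> (real r + 1) * wish_gamma q r * real (wish_reps n q r \<delta>)"
    unfolding wish_reps_def y_def using wish_gamma_pos
    by (intro mult_left_mono real_nat_ceiling_ge) auto
  also have "\<dots> \<le> 2 * (1 / 2 - 1 / (1 + Q))\<^sup>2 * real (wish_reps n q r \<delta>)"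
    using wish_gamma_le_hoeffding_exponent by (intro mult_right_mono) auto
  finally have "median_error n \<delta> \<le> exp (real (r + 1) * - y)"
    by (simp add: median_error_def)
  also have "\<dots> = exp (- y) ^ (r + 1)"
    by (rule exp_of_nat_mult)
  also have "exp (- y) = \<delta> / (2 * real n)"
    using assms by (simp add: y_def exp_minus)
  finally show ?thesis .
qed

lemma wish_levels_median_error_le:
  assumes "n \<ge> 1" "0 < \<delta>" "\<delta> < 1"
  shows "2 * real (wish_levels n q r) * median_error n \<delta> \<le> \<delta>"
proof -
  have "2 * wish_levels n q r \<le> 2 * (n * r)"
    using wish_levels_le by (rule mult_le_mono2)
  also have "\<dots> \<le> n ^ (r + 1) * 2 ^ (r + 1)"
    using mult_le_mono[OF self_le_power[of n "r + 1"] less_imp_le[OF less_exp[of r]]] assms(1)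
    by simp
  also have "\<dots> = (2 * n) ^ (r + 1)"
    by (simp only: power_mult_distrib mult.commute)
  finally have "real (2 * wish_levels n q r) \<le> real ((2 * n) ^ (r + 1))"
    by (rule of_nat_mono)
  then have "2 * real (wish_levels n q r) \<le> (2 * real n) ^ (r + 1)"
    by simp
  then have "2 * real (wish_levels n q r) * median_error n \<delta>
    \<le> (2 * real n) ^ (r + 1) * (\<delta> / (2 * real n)) ^ (r + 1)"
    using median_error_le[OF assms] by (rule mult_mono) (auto simp: median_error_def)
  also have "\<dots> = (2 * real n * (\<delta> / (2 * real n))) ^ (r + 1)"
    by (rule power_mult_distrib[symmetric])
  also have "\<dots> = \<delta> ^ (r + 1)"
    using assms(1) by simp
  also have "\<dots> \<le> \<delta>"
    using assms power_decreasing[of 1 "r + 1" \<delta>] by simp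
  finally show ?thesis .
qed

lemma ratio_square_diff_le:
  assumes "1 \<le> m" "m < q"
  shows "\<bar>Q\<^sup>2 - 4\<bar> \<le> 36 * (1 / real m)"
proof -
  have "Q - 2 = (real q - 2 * real r) / real r"
    using r_pos by (simp add: field_simps)
  also have "\<dots> \<le> 2 / real r"
    using real_q_bounds by (intro divide_right_mono) auto
  also have "\<dots> \<le> 2 * (3 / real m)"
    using assms real_r_ge_1 real_q_bounds by (simp add: field_simps)
  finally have "(Q - 2) * (Q + 2) \<le> 2 * (3 / real m) * 6"
    using ratio_bounds by (intro mult_mono) auto
  moreover have "(Q - 2) * (Q + 2) = Q\<^sup>2 - 4"
    by (simp add: power2_eq_square algebra_simps)
  moreover have "0 \<le> (Q - 2) * (Q + 2)"
    using ratio_bounds by (intro mult_nonneg_nonneg) auto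
  ultimately show ?thesis
    by simp
qed

lemma wish_calls_ge:
  assumes "0 < \<epsilon>" "1 \<le> real m / \<epsilon>"
  shows "log Q (real q) / wish_gamma q r * (real m * ln (real m / \<epsilon>))
    \<le> real (wish_calls m q r \<epsilon>)"
proof -
  have "m > 0"
    using assms by (cases m) auto
  then have "ln (real m / \<epsilon>) \<le> ln (2 * real m / \<epsilon>)"
    using assms(1) by (subst ln_le_cancel_iff) (auto simp: divide_right_mono)
  then have "1 / wish_gamma q r * ln (real m / \<epsilon>) \<le> 1 / wish_gamma q r * ln (2 * real m / \<epsilon>)"
    using wish_gamma_pos by (intro mult_left_mono) auto
  also have "\<dots> \<le> real (wish_reps m q r \<epsilon>)"
    unfolding wish_reps_def by (rule real_nat_ceiling_ge)
  finally have "real m * log Q (real q) * (1 / wish_gamma q r * ln (real m / \<epsilon>)) \<le>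
      real (wish_levels m q r) * real (wish_reps m q r \<epsilon>)"
    using wish_gamma_pos assms(2)
    by (intro mult_mono) (auto simp: wish_levels_def real_nat_ceiling_ge)
  then show ?thesis
    by (simp add: wish_calls_eq mult_ac)
qed

lemma wish_calls_le:
  assumes "0 < \<epsilon>" "1 < c" "c \<le> real m / \<epsilon>"
  shows "real (wish_calls m q r \<epsilon>) \<le> 4 * (1 + ln 2 / ln c) *
    (log Q (real q) / wish_gamma q r * (real m * ln (real m / \<epsilon>)))"
proof -
  define g v where "g = 1 / wish_gamma q r" and "v = ln (real m / \<epsilon>)"
  have m: "1 \<le> real m"
    using assms by (cases m) auto
  have g: "12 \<le> g"
    using wish_gamma_le wish_gamma_pos by (simp add: g_def field_simps)
  have v: "0 < ln c" "ln c \<le> v"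
    using assms by (auto simp: v_def)
  have "ln 2 * 1 \<le> ln 2 * (v / ln c)"
    using v by (intro mult_left_mono) auto
  then have v_scaled: "ln 2 + v \<le> (1 + ln 2 / ln c) * v"
    by (simp add: algebra_simps)
  have "1 * 1 \<le> real m * log Q (real q)"
    using m log_ratio_bounds(1) by (intro mult_mono) auto
  then have levels: "real (wish_levels m q r) \<le> 2 * (real m * log Q (real q))"
    unfolding wish_levels_def by (intro nat_ceiling_le_double) simp
  have "12 * (2 / 3) \<le> g * (ln 2 + v)"
    using g v ln2_ge_two_thirds by (intro mult_mono) auto
  moreover have "ln (2 * real m / \<epsilon>) = ln 2 + v"
    using assms m by (simp add: v_def ln_div ln_mult)
  ultimately have "real (wish_reps m q r \<epsilon>) \<le> 2 * (g * (ln 2 + v))"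
    unfolding wish_reps_def g_def by (intro order_trans[OF nat_ceiling_le_double]) auto
  also have "\<dots> \<le> 2 * (g * ((1 + ln 2 / ln c) * v))"
    using v_scaled g by (intro mult_left_mono) auto
  finally have "real (wish_calls m q r \<epsilon>) \<le>
      2 * (real m * log Q (real q)) * (2 * (g * ((1 + ln 2 / ln c) * v)))"
    unfolding wish_calls_eq of_nat_mult using levels m log_ratio_bounds(1)
    by (intro mult_mono) auto
  then show ?thesis
    by (simp add: g_def v_def mult_ac del: distrib_left_numeral)
qed

end

lemma ratio_square_bigo:
  "(\<lambda>(m, p). (real p / real (wish_r p))\<^sup>2 - 4)
    \<in> O[principal {(m, p). 1 \<le> m \<and> m < p \<and> primepow p \<and> wish_r p > 0}](\<lambda>(m, p). 1 / real m)"
proof (rule bigoI[where c = 36])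
  show "\<forall>\<^sub>F x in principal {(m, p). 1 \<le> m \<and> m < p \<and> primepow p \<and> wish_r p > 0}.
      norm (case x of (m, p) \<Rightarrow> (real p / real (wish_r p))\<^sup>2 - 4)
        \<le> 36 * norm (case x of (m, p) \<Rightarrow> 1 / real m)"
    using wish_parameters.ratio_square_diff_le[unfolded wish_parameters_def]
    by (auto simp: eventually_principal)
qed

lemma wish_calls_bigtheta:
  assumes "1 < c"
  shows "(\<lambda>(m, p, \<epsilon>). real (wish_calls m p (wish_r p) \<epsilon>))
    \<in> \<Theta>[principal {(m, p, \<epsilon>). 1 \<le> m \<and> m < p \<and> primepow p \<and> wish_r p > 0 \<and>
         0 < \<epsilon> \<and> c \<le> real m / \<epsilon>}](
       \<lambda>(m, p, \<epsilon>). log (real p / real (wish_r p)) (real p) / wish_gamma p (wish_r p) *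
         (real m * ln (real m / \<epsilon>)))"
proof -
  define K where "K m p \<epsilon> = log (real p / real (wish_r p)) (real p) / wish_gamma p (wish_r p) *
    (real m * ln (real m / \<epsilon>))" for m p and \<epsilon> :: real
  have "K m p \<epsilon> \<le> real (wish_calls m p (wish_r p) \<epsilon>)"
    "real (wish_calls m p (wish_r p) \<epsilon>) \<le> 4 * (1 + ln 2 / ln c) * K m p \<epsilon>" "0 \<le> K m p \<epsilon>"
    if "wish_r p > 0" "0 < \<epsilon>" "c \<le> real m / \<epsilon>" for m p \<epsilon>
  proof -
    interpret wish_parameters p "wish_r p"
      using that(1) by unfold_locales auto
    have m_\<epsilon>: "1 \<le> real m / \<epsilon>"
      using that(3) assms by linarith
    with that(2) show "K m p \<epsilon> \<le> real (wish_calls m p (wish_r p) \<epsilon>)"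
      unfolding K_def by (rule wish_calls_ge)
    show "real (wish_calls m p (wish_r p) \<epsilon>) \<le> 4 * (1 + ln 2 / ln c) * K m p \<epsilon>"
      unfolding K_def using that assms by (intro wish_calls_le) auto
    show "0 \<le> K m p \<epsilon>"
      unfolding K_def using that(2) m_\<epsilon> log_ratio_bounds(1) wish_gamma_pos
      by (intro mult_nonneg_nonneg divide_nonneg_pos ln_ge_zero) auto
  qed
  then show ?thesis
    unfolding K_def[symmetric] using assms
    by (intro bigthetaI'[of 1 "4 * (1 + ln 2 / ln c)"])
       (auto simp: eventually_principal add_pos_nonneg)
qed

lemma wish_calls_bigtheta_fixed_field:
  assumes "1 < c" "primepow q" "wish_r q > 0"
  shows "(\<lambda>(m, \<epsilon>). real (wish_calls m q (wish_r q) \<epsilon>))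
    \<in> \<Theta>[principal {(m, \<epsilon>). 1 \<le> m \<and> m < q \<and> 0 < \<epsilon> \<and> c \<le> real m / \<epsilon>}](
       \<lambda>(m, \<epsilon>). real m * ln (real m / \<epsilon>))"
proof -
  interpret wish_parameters q "wish_r q"
    using assms(3) by unfold_locales auto
  define F where "F = principal {(m, \<epsilon>). 1 \<le> m \<and> m < q \<and> 0 < \<epsilon> \<and> c \<le> real m / \<epsilon>}"
  have "filterlim (\<lambda>(m, \<epsilon>). (m, q, \<epsilon>)) (principal {(m, p, \<epsilon>). 1 \<le> m \<and> m < p \<and> primepow p \<and>
      wish_r p > 0 \<and> 0 < \<epsilon> \<and> c \<le> real m / \<epsilon>}) F"
    using assms by (auto simp: F_def filterlim_principal eventually_principal)
  from landau_theta.compose[OF wish_calls_bigtheta[OF assms(1)] this]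
  have "(\<lambda>(m, \<epsilon>). real (wish_calls m q (wish_r q) \<epsilon>))
    \<in> \<Theta>[F](\<lambda>x. log Q (real q) / wish_gamma q (wish_r q) *
      (case x of (m, \<epsilon>) \<Rightarrow> real m * ln (real m / \<epsilon>)))"
    by (simp add: case_prod_unfold)
  moreover have "log Q (real q) / wish_gamma q (wish_r q) \<noteq> 0"
    using log_ratio_bounds(1) wish_gamma_pos by auto
  ultimately show ?thesis
    unfolding F_def[symmetric] by simp
qed

section \<open>Accuracy of the estimate\<close>

locale perm_wish_input = wish_parameters q r for q r :: nat +
  fixes n :: nat and D :: "real mat" and \<alpha> :: "nat \<Rightarrow> 'f::{field,finite}"
  assumes n_pos: "n \<ge> 1" and D_carrier: "D \<in> carrier_mat n n"
    and D_nonneg: "\<And>i j. i < n \<Longrightarrow> j < n \<Longrightarrow> D $$ (i, j) \<ge> 0"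
    and n_less: "n < q" and card_field: "CARD('f) = q" and enum: "bij_betw \<alpha> {0..<q} UNIV"
begin

abbreviation perms :: "(nat \<Rightarrow> nat) set" where
  "perms \<equiv> {\<sigma>. \<sigma> permutes {0..<n}}"

abbreviation hash :: "nat \<Rightarrow> ('f mat \<times> 'f Matrix.vec) pmf" where
  "hash i \<equiv> pair_pmf (uniform_mat i n) (uniform_vec i)"

abbreviation ranked_weight :: "nat \<Rightarrow> real" where
  "ranked_weight \<equiv> decreasing_rearrangement (perm_weight D) perms"

definition survival :: "(nat \<Rightarrow> nat) \<Rightarrow> ('f mat \<times> 'f Matrix.vec) set" where
  "survival \<sigma> = {(A, b). enum_vec_less \<alpha> (A *\<^sub>v perm_vec \<alpha> n \<sigma> + b)
    (\<alpha> r \<cdot>\<^sub>v Matrix.vec (dim_row A) (\<lambda>_. 1))}"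

lemma dim_row_D: "dim_row D = n"
  using D_carrier by simp

lemma finite_perms: "finite perms"
  by (simp add: finite_permutations)

lemma perms_nonempty: "perms \<noteq> {}"
  using permutes_id by blast

lemma perm_weight_nonneg: "\<sigma> \<in> perms \<Longrightarrow> 0 \<le> perm_weight D \<sigma>"
  unfolding perm_weight_def dim_row_D using permutes_in_image[of \<sigma> "{0..<n}"]
  by (intro prod_nonneg) (auto intro: D_nonneg)

lemma antimono_ranked_weight: "antimono ranked_weight"
  by (intro antimono_decreasing_rearrangement perm_weight_nonneg)

lemma permanent_eq_sum_ranked_weight: "permanent D = (\<Sum>k<card perms. ranked_weight k)"
  by (simp add: permanent_def dim_row_D sum_decreasing_rearrangement)

lemma max_oracle_eq_max_weight:
  "max_oracle \<alpha> r D (fst x) (snd x) = max_weight (perm_weight D) {\<sigma> \<in> perms. x \<in> survival \<sigma>}"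
proof (cases x)
  case (Pair A b)
  have "{perm_weight D \<sigma> | \<sigma>. \<sigma> permutes {0..<n} \<and> enum_vec_less \<alpha> (A *\<^sub>v perm_vec \<alpha> n \<sigma> + b)
      (\<alpha> r \<cdot>\<^sub>v Matrix.vec (dim_row A) (\<lambda>_. 1))} =
    perm_weight D ` {\<sigma> \<in> perms. (A, b) \<in> survival \<sigma>}"
    by (auto simp: survival_def)
  then show ?thesis
    by (simp only: max_oracle_def max_weight_def Let_def dim_row_D Pair fst_conv snd_conv
        image_is_empty)
qed

lemma inj_on_enum: "inj_on \<alpha> {0..<q}"
  using enum by (rule bij_betw_imp_inj_on)

lemma perm_vec_carrier: "perm_vec \<alpha> n \<sigma> \<in> carrier_vec n"
  by (simp add: perm_vec_def)

lemma inj_on_perm_vec: "inj_on (perm_vec \<alpha> n) perms"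
proof (intro inj_onI ext)
  fix \<sigma> \<tau> k assume perms: "\<sigma> \<in> perms" "\<tau> \<in> perms" and eq: "perm_vec \<alpha> n \<sigma> = perm_vec \<alpha> n \<tau>"
  show "\<sigma> k = \<tau> k"
  proof (cases "k < n")
    case True
    then have "\<alpha> (\<sigma> k) = \<alpha> (\<tau> k)"
      using eq by (metis perm_vec_def index_vec)
    moreover have "\<sigma> k < n" "\<tau> k < n"
      using True perms permutes_in_image[of _ "{0..<n}" k] by auto
    ultimately show ?thesis
      using inj_on_enum n_less by (auto simp: inj_on_def)
  next
    case False
    then show ?thesis
      using perms by (auto simp: permutes_def)
  qed
qed

lemma card_enum_less: "card {z. enum_less \<alpha> z (\<alpha> r)} = r"
proof -
  have "r < q"
    using q_cases by auto
  then have "{z. enum_less \<alpha> z (\<alpha> r)} = \<alpha> ` {..<r}"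
    using inj_on_eq_iff[OF inj_on_enum, of r] by (auto simp: enum_less_def card_field)
  moreover have "inj_on \<alpha> {..<r}"
    using \<open>r < q\<close> by (intro inj_on_subset[OF inj_on_enum]) auto
  ultimately show ?thesis
    by (simp add: card_image)
qed

lemma prob_uniform_vec_below:
  "measure_pmf.prob (uniform_vec i) {u. enum_vec_less \<alpha> u (\<alpha> r \<cdot>\<^sub>v Matrix.vec i (\<lambda>_. 1))} =
    (1 / Q) ^ i"
proof -
  have "measure_pmf.prob (uniform_vec i) {u. enum_vec_less \<alpha> u (\<alpha> r \<cdot>\<^sub>v Matrix.vec i (\<lambda>_. 1))} =
      measure_pmf.prob (uniform_vec i) {u. \<forall>j<i. u $ j \<in> {z. enum_less \<alpha> z (\<alpha> r)}}"
    by (rule measure_pmf.finite_measure_eq_AE)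
       (auto simp: AE_measure_pmf_iff set_pmf_uniform_vec enum_vec_less_def)
  then show ?thesis
    by (simp only: prob_uniform_vec_all card_enum_less card_field inverse_ratio)
qed

lemma prob_survival: "measure_pmf.prob (hash i) (survival \<sigma>) = (1 / Q) ^ i"
proof -
  have "measure_pmf.prob (hash i) (survival \<sigma>) =
      measure_pmf.prob (map_pmf (\<lambda>(A, b). A *\<^sub>v perm_vec \<alpha> n \<sigma> + b) (hash i))
        {u. enum_vec_less \<alpha> u (\<alpha> r \<cdot>\<^sub>v Matrix.vec i (\<lambda>_. 1))}"
    unfolding measure_map_pmf
    by (rule measure_pmf.finite_measure_eq_AE)
       (auto simp: AE_measure_pmf_iff set_pmf_uniform_mat survival_def)
  then show ?thesis
    by (simp only: map_pmf_uniform_affine[OF perm_vec_carrier] prob_uniform_vec_below)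
qed

lemma prob_survival_Int:
  assumes "\<sigma> \<in> perms" "\<tau> \<in> perms" "\<sigma> \<noteq> \<tau>"
  shows "measure_pmf.prob (hash i) (survival \<sigma> \<inter> survival \<tau>) = ((1 / Q) ^ i)\<^sup>2"
proof -
  define U where "U = {u. enum_vec_less \<alpha> u (\<alpha> r \<cdot>\<^sub>v Matrix.vec i (\<lambda>_. 1))}"
  have "measure_pmf.prob (hash i) (survival \<sigma> \<inter> survival \<tau>) =
      measure_pmf.prob
        (map_pmf (\<lambda>(A, b). (A *\<^sub>v perm_vec \<alpha> n \<sigma> + b, A *\<^sub>v perm_vec \<alpha> n \<tau> + b)) (hash i))
        (U \<times> U)"
    unfolding measure_map_pmf
    by (rule measure_pmf.finite_measure_eq_AE)
       (auto simp: AE_measure_pmf_iff set_pmf_uniform_mat survival_def U_def)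
  also have "\<dots> = measure_pmf.prob (pair_pmf (uniform_vec i) (uniform_vec i)) (U \<times> U)"
    using assms inj_on_perm_vec
    by (subst map_pmf_uniform_affine_pair[OF perm_vec_carrier perm_vec_carrier])
       (auto simp: inj_on_def)
  also have "\<dots> = measure_pmf.prob (pair_pmf (uniform_vec i) (uniform_vec i))
      ((U \<inter> carrier_vec i) \<times> (U \<inter> carrier_vec i))"
    by (rule measure_pmf.finite_measure_eq_AE) (auto simp: AE_measure_pmf_iff set_pmf_uniform_vec)
  also have "\<dots> = measure_pmf.prob (uniform_vec i) U * measure_pmf.prob (uniform_vec i) U"
    using measure_Int_set_pmf[of "uniform_vec i" U]
    by (subst measure_pmf_prob_product)
       (auto simp: set_pmf_uniform_vec intro: countable_finite finite_carrier_vec)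
  finally show ?thesis
    by (simp add: U_def prob_uniform_vec_below power2_eq_square)
qed

lemma prob_max_oracle_gt:
  "measure_pmf.prob (hash (Suc i))
      {x. ranked_weight (nat \<lfloor>Q ^ i / Q\<rfloor>) < max_oracle \<alpha> r D (fst x) (snd x)}
    \<le> 1 / (1 + Q)"
proof -
  have "measure_pmf.prob (hash (Suc i))
      {x. ranked_weight (nat \<lfloor>Q ^ i / Q\<rfloor>) < max_oracle \<alpha> r D (fst x) (snd x)}
    \<le> real (nat \<lfloor>Q ^ i / Q\<rfloor>) * (1 / Q) ^ Suc i"
    unfolding max_oracle_eq_max_weight using ratio_bounds
    by (intro prob_max_weight_gt_rearrangement finite_perms perm_weight_nonneg)
       (auto simp: prob_survival)
  also have "\<dots> \<le> Q ^ i / Q * (1 / Q) ^ Suc i"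
    using ratio_bounds by (intro mult_right_mono of_nat_floor) auto
  also have "\<dots> = 1 / (Q * Q)"
    using ratio_bounds by (simp add: power_divide)
  also have "\<dots> \<le> 1 / (1 + Q)"
  proof -
    have "2 * Q \<le> Q * Q"
      using ratio_bounds by (intro mult_right_mono) auto
    then show ?thesis
      using ratio_bounds by (intro frac_le) linarith+
  qed
  finally show ?thesis .
qed

lemma prob_max_oracle_lt:
  "measure_pmf.prob (hash (Suc i))
      {x. max_oracle \<alpha> r D (fst x) (snd x) < ranked_weight (nat \<lfloor>Q ^ (i + 2)\<rfloor>)}
    \<le> 1 / (1 + Q)"
proof -
  have "measure_pmf.prob (hash (Suc i))
      {x. max_oracle \<alpha> r D (fst x) (snd x) < ranked_weight (nat \<lfloor>Q ^ (i + 2)\<rfloor>)}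
    \<le> 1 / (1 + real (Suc (nat \<lfloor>Q ^ (i + 2)\<rfloor>)) * (1 / Q) ^ Suc i)"
    unfolding max_oracle_eq_max_weight using ratio_bounds
    by (intro prob_max_weight_lt_rearrangement finite_perms perm_weight_nonneg
        prob_survival prob_survival_Int) auto
  also have "\<dots> \<le> 1 / (1 + Q)"
  proof -
    have "Q ^ (i + 2) * (1 / Q) ^ Suc i = Q"
      using ratio_bounds by (simp add: power_divide)
    moreover have "Q ^ (i + 2) * (1 / Q) ^ Suc i \<le>
        real (Suc (nat \<lfloor>Q ^ (i + 2)\<rfloor>)) * (1 / Q) ^ Suc i"
      using ratio_bounds by (intro mult_right_mono) (linarith, simp)
    ultimately show ?thesis
      using ratio_bounds by (intro divide_left_mono mult_pos_pos) linarith+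
  qed
  finally show ?thesis .
qed

lemma wish_median_eq_median_map:
  "wish_median \<alpha> D q r \<delta> S i =
    median (map (\<lambda>j. max_oracle \<alpha> r D (fst (S j)) (snd (S j)))
      (map (Pair i) [1..<Suc (wish_reps n q r \<delta>)]))"
  by (simp add: wish_median_def dim_row_D o_def del: upt_Suc)

lemma
  assumes "i < wish_levels n q r"
  shows prob_wish_median_gt: "measure_pmf.prob (wish_samples n q r \<delta>)
      {S. ranked_weight (nat \<lfloor>Q ^ i / Q\<rfloor>) < wish_median \<alpha> D q r \<delta> S (Suc i)}
      \<le> median_error n \<delta>"
    and prob_wish_median_lt: "measure_pmf.prob (wish_samples n q r \<delta>)
      {S. wish_median \<alpha> D q r \<delta> S (Suc i) < ranked_weight (nat \<lfloor>Q ^ (i + 2)\<rfloor>)}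
      \<le> median_error n \<delta>"
proof -
  define js where "js = map (Pair (Suc i)) [1..<Suc (wish_reps n q r \<delta>)]"
  have js: "finite (wish_queries n q r \<delta>)" "set js \<subseteq> wish_queries n q r \<delta>" "distinct js"
    using assms(1) by (auto simp: js_def wish_queries_def distinct_map inj_on_def)
  have length_js: "length js = wish_reps n q r \<delta>"
    by (simp add: js_def)
  have hash: "(case j of (i, k) \<Rightarrow> hash i) = hash (Suc i)" if "j \<in> set js" for j
    using that by (auto simp: js_def)
  have "1 / (1 + Q) \<le> 1 / 2"
    using ratio_bounds by (intro frac_le) auto
  note median =
    prob_Pi_pmf_median_gt[OF js this, unfolded length_js]
    prob_Pi_pmf_median_lt[OF js this, unfolded length_js]
  show "measure_pmf.prob (wish_samples n q r \<delta>)
      {S. ranked_weight (nat \<lfloor>Q ^ i / Q\<rfloor>) < wish_median \<alpha> D q r \<delta> S (Suc i)}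
      \<le> median_error n \<delta>"
    unfolding wish_samples_def wish_median_eq_median_map js_def[symmetric] median_error_def
    by (rule median(1)) (simp only: hash prob_max_oracle_gt)
  show "measure_pmf.prob (wish_samples n q r \<delta>)
      {S. wish_median \<alpha> D q r \<delta> S (Suc i) < ranked_weight (nat \<lfloor>Q ^ (i + 2)\<rfloor>)}
      \<le> median_error n \<delta>"
    unfolding wish_samples_def wish_median_eq_median_map js_def[symmetric] median_error_def
    by (rule median(2)) (simp only: hash prob_max_oracle_lt)
qed

definition accurate_medians :: "(nat \<Rightarrow> real) \<Rightarrow> nat \<Rightarrow> bool" where
  "accurate_medians M L \<longleftrightarrow>
    (\<forall>i<L. ranked_weight (nat \<lfloor>Q ^ (i + 2)\<rfloor>) \<le> M (Suc i) \<and>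
      M (Suc i) \<le> ranked_weight (nat \<lfloor>Q ^ i / Q\<rfloor>))"

lemma prob_inaccurate_medians_le:
  assumes "0 < \<delta>" "\<delta> < 1"
  shows "measure_pmf.prob (wish_samples n q r \<delta>)
    {S. \<not> accurate_medians (wish_median \<alpha> D q r \<delta> S) (wish_levels n q r)} \<le> \<delta>"
proof -
  define P where "P = (wish_samples n q r \<delta> :: (nat \<times> nat \<Rightarrow> 'f mat \<times> 'f Matrix.vec) pmf)"
  define L where "L = wish_levels n q r"
  define Hi where "Hi i =
    {S. ranked_weight (nat \<lfloor>Q ^ i / Q\<rfloor>) < wish_median \<alpha> D q r \<delta> S (Suc i)}" for i
  define Lo where "Lo i =
    {S. wish_median \<alpha> D q r \<delta> S (Suc i) < ranked_weight (nat \<lfloor>Q ^ (i + 2)\<rfloor>)}" for i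
  have "{S. \<not> accurate_medians (wish_median \<alpha> D q r \<delta> S) L} = (\<Union>i<L. Hi i \<union> Lo i)"
    by (auto simp: accurate_medians_def Hi_def Lo_def not_le)
  also have "measure_pmf.prob P \<dots> \<le> (\<Sum>i<L. measure_pmf.prob P (Hi i \<union> Lo i))"
    by (rule measure_pmf.finite_measure_subadditive_finite) auto
  also have "\<dots> \<le> (\<Sum>i<L. median_error n \<delta> + median_error n \<delta>)"
    unfolding P_def L_def Hi_def Lo_def
    by (intro sum_mono order_trans[OF measure_Un_le] add_mono prob_wish_median_gt
        prob_wish_median_lt) auto
  also have "\<dots> = 2 * real L * median_error n \<delta>"
    by simp
  also have "\<dots> \<le> \<delta>"
    unfolding L_def using n_pos assms by (rule wish_levels_median_error_le)
  finally show ?thesis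
    by (simp add: P_def L_def)
qed

lemma wish_estimate_eq:
  "wish_estimate \<alpha> D q r \<delta> S = ranked_weight 0 +
    (Q - 1) * (\<Sum>i<wish_levels n q r. wish_median \<alpha> D q r \<delta> S (Suc i) * Q ^ i)"
  unfolding wish_estimate_def dim_row_D
  by (simp add: decreasing_rearrangement_0[OF finite_perms perms_nonempty])

lemma wish_estimate_bounds:
  assumes accurate: "accurate_medians (wish_median \<alpha> D q r \<delta> S) (wish_levels n q r)"
  shows "permanent D \<le> Q\<^sup>2 * wish_estimate \<alpha> D q r \<delta> S"
    and "wish_estimate \<alpha> D q r \<delta> S \<le> Q\<^sup>2 * permanent D"
proof -
  define L where "L = wish_levels n q r"
  define f where "f x = ranked_weight (nat \<lfloor>x\<rfloor>)" for x :: real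
  have f: "antimono_on {0..} f"
    unfolding f_def by (rule antimono_on_comp_floor[OF antimono_ranked_weight])
  have f_0: "f x = ranked_weight 0" if "0 \<le> x" "x < 1" for x
    using that by (simp add: f_def floor_eq_iff)
  have Q: "1 \<le> Q"
    using ratio_bounds by simp
  note integral_bounds =
    integral_floor_bounds[OF antimono_ranked_weight decreasing_rearrangement_zero, folded f_def]
  have "real (card perms) \<le> Q ^ L"
    using fact_le_power_wish_levels[of n] n_less by (simp add: card_permutations L_def)
  also have "\<dots> \<le> Q ^ (L + 2)"
    using Q by (intro power_increasing) auto
  finally have "permanent D \<le> integral {0..Q ^ (L + 2)} f"
    unfolding permanent_eq_sum_ranked_weight by (intro integral_bounds(2)) auto
  also have "\<dots> \<le> Q\<^sup>2 * (f 0 + (Q - 1) * (\<Sum>i<L. wish_median \<alpha> D q r \<delta> S (Suc i) * Q ^ i))"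
    using accurate
    by (intro geometric_upper_quadrature f Q) (auto simp: accurate_medians_def L_def f_def)
  finally show "permanent D \<le> Q\<^sup>2 * wish_estimate \<alpha> D q r \<delta> S"
    by (simp add: wish_estimate_eq f_0 L_def)
  have "1 < Q\<^sup>2"
    using ratio_bounds by (intro one_less_power) auto
  then have "f (1 / Q\<^sup>2) = ranked_weight 0"
    by (intro f_0) (auto simp only: divide_less_eq_1_pos zero_le_divide_1_iff)
  then have "wish_estimate \<alpha> D q r \<delta> S =
      f (1 / Q\<^sup>2) + (Q - 1) * (\<Sum>i<L. wish_median \<alpha> D q r \<delta> S (Suc i) * Q ^ i)"
    by (simp only: wish_estimate_eq L_def)
  also have "\<dots> \<le> Q\<^sup>2 * integral {0..Q ^ L / Q\<^sup>2} f"
    using accurate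
    by (intro geometric_lower_quadrature f Q) (auto simp: accurate_medians_def L_def f_def)
  also have "\<dots> \<le> Q\<^sup>2 * permanent D"
    unfolding permanent_eq_sum_ranked_weight by (intro mult_left_mono integral_bounds(1)) auto
  finally show "wish_estimate \<alpha> D q r \<delta> S \<le> Q\<^sup>2 * permanent D" .
qed

lemma perm_wish_approximation:
  assumes "\<delta> > 0"
  shows "1 - \<delta> \<le> measure_pmf.prob (perm_wish \<alpha> D q r \<delta>)
    {Z. permanent D / Q\<^sup>2 \<le> Z \<and> Z \<le> Q\<^sup>2 * permanent D}"
proof (cases "\<delta> < 1")
  case True
  define Accurate where "Accurate =
    {S. accurate_medians (wish_median \<alpha> D q r \<delta> S) (wish_levels n q r)}"
  have "1 - \<delta> \<le> 1 - measure_pmf.prob (wish_samples n q r \<delta>) (- Accurate)"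
    using prob_inaccurate_medians_le[OF assms True] by (simp add: Accurate_def Collect_neg_eq)
  also have "\<dots> = measure_pmf.prob (wish_samples n q r \<delta>) Accurate"
    using measure_pmf.prob_compl[of Accurate "wish_samples n q r \<delta>"]
    by (simp add: Compl_eq_Diff_UNIV)
  also have "\<dots> \<le> measure_pmf.prob (wish_samples n q r \<delta>) (wish_estimate \<alpha> D q r \<delta> -`
      {Z. permanent D / Q\<^sup>2 \<le> Z \<and> Z \<le> Q\<^sup>2 * permanent D})"
    using wish_estimate_bounds ratio_bounds
    by (intro measure_pmf.finite_measure_mono) (auto simp: Accurate_def divide_le_eq mult.commute)
  finally show ?thesis
    by (simp add: perm_wish_def dim_row_D)
next
  case False
  then show ?thesis
    by (intro order_trans[OF _ measure_nonneg]) simp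
qed

end

theorem theorem2:
  fixes n q r :: nat and D :: "real mat" and \<alpha> :: "nat \<Rightarrow> 'f::{field,finite}" and \<delta> :: real
  assumes "n \<ge> 1"
    and "D \<in> carrier_mat n n"
    and "\<And>i j. i < n \<Longrightarrow> j < n \<Longrightarrow> D $$ (i, j) \<ge> 0"
    and "primepow q" and "q > n"
    and "CARD('f) = q" and "bij_betw \<alpha> {0..<q} UNIV"
    and "r = wish_r q" and "r > 0"
    and "\<delta> > 0"
  shows "measure_pmf.prob (perm_wish \<alpha> D q r \<delta>)
           {Z. permanent D / (real q / real r)\<^sup>2 \<le> Z \<and>
               Z \<le> (real q / real r)\<^sup>2 * permanent D} \<ge> 1 - \<delta>
    \<and> (\<lambda>(m, p). (real p / real (wish_r p))\<^sup>2 - 4)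
        \<in> O[principal {(m, p). 1 \<le> m \<and> m < p \<and> primepow p \<and> wish_r p > 0}](
           \<lambda>(m, p). 1 / real m)
    \<and> (\<forall>c>1. (\<lambda>(m, \<epsilon>). real (wish_calls m q r \<epsilon>))
        \<in> \<Theta>[principal {(m, \<epsilon>). 1 \<le> m \<and> m < q \<and> 0 < \<epsilon> \<and> c \<le> real m / \<epsilon>}](
           \<lambda>(m, \<epsilon>). real m * ln (real m / \<epsilon>)))
    \<and> (\<forall>c>1. (\<lambda>(m, p, \<epsilon>). real (wish_calls m p (wish_r p) \<epsilon>))
        \<in> \<Theta>[principal {(m, p, \<epsilon>). 1 \<le> m \<and> m < p \<and> primepow p \<and> wish_r p > 0 \<and>
               0 < \<epsilon> \<and> c \<le> real m / \<epsilon>}](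
           \<lambda>(m, p, \<epsilon>). log (real p / real (wish_r p)) (real p) / wish_gamma p (wish_r p) *
              (real m * ln (real m / \<epsilon>))))"
proof (intro conjI allI impI)
  interpret perm_wish_input q r n D \<alpha>
    using assms by unfold_locales auto
  show "measure_pmf.prob (perm_wish \<alpha> D q r \<delta>)
           {Z. permanent D / (real q / real r)\<^sup>2 \<le> Z \<and>
               Z \<le> (real q / real r)\<^sup>2 * permanent D} \<ge> 1 - \<delta>"
    using \<open>\<delta> > 0\<close> by (rule perm_wish_approximation)
next
  show "(\<lambda>(m, \<epsilon>). real (wish_calls m q r \<epsilon>))
        \<in> \<Theta>[principal {(m, \<epsilon>). 1 \<le> m \<and> m < q \<and> 0 < \<epsilon> \<and> c \<le> real m / \<epsilon>}](
           \<lambda>(m, \<epsilon>). real m * ln (real m / \<epsilon>))" if "c > 1" for c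
    using wish_calls_bigtheta_fixed_field[OF that \<open>primepow q\<close>] assms by simp
qed (rule ratio_square_bigo, rule wish_calls_bigtheta)

end
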